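(* Let $1\le n<N$ be integers and let $K\subset\mathbb{R}^N$ be a convex body containing the origin in its interior. Then for every linear subspace $F\subset\mathbb{R}^N$ of dimension $n+1$ and for every $t>0$, $$\mathcal{R}_n(K)\ge\frac{\sqrt n}{2\left(\ell(K\cap F)+t\,R((K\cap F)^\circ)\right)}$$ with probability at least $$1-e^{-n/8}-e^{-t^2/2}.$$
   Context: $|\cdot|$ is the Euclidean norm. A convex body is a compact convex set containing the origin in its interior (not necessarily symmetric). $K\cap F$ is regarded as a convex body in the Euclidean space $F$. For a convex body $L$ in a Euclidean space $H$: $\|x\|_L=\inf\{\lambda>0: x\in\lambda L\}$ is its gauge, $L^\circ=\{y\in H:\langle x,y\rangle\le1\ \forall x\in L\}$ its polar (taken in $H$), $R(L)=\max_{y\in L}|y|$, and $\ell(L)=\mathbb{E}\|G\|_L$ with $G$ a standard Gaussian vector in $H$. The $n$-th random radius is the random variable $\mathcal{R}_n(K)=\max_{y\in E_n\cap K}|y|$, where $E_n$ is a random $n$-codimensional linear subspace of $\mathbb{R}^N$ distributed according to the normalized Haar measure on the Grassmannian. Probability is with respect to $E_n$. *)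

theory Defs
  imports "HOL-Probability.Probability"
begin

definition convex_body :: "'a::euclidean_space set \<Rightarrow> bool" where
  "convex_body K \<longleftrightarrow> compact K \<and> convex K \<and> 0 \<in> interior K"

definition body_gauge :: "'a::euclidean_space set \<Rightarrow> 'a \<Rightarrow> real" where
  "body_gauge L x = Inf {c. 0 < c \<and> x \<in> (\<lambda>y. c *\<^sub>R y) ` L}"

(* The polar is taken inside the subspace H, not in the ambient space. *)
definition polar_in :: "'a::euclidean_space set \<Rightarrow> 'a set \<Rightarrow> 'a set" where
  "polar_in H L = {y \<in> H. \<forall>x\<in>L. y \<bullet> x \<le> 1}"

(* For nonempty compact L the supremum is attained, so this is the maximum of the norm. *)
definition outer_radius :: "'a::euclidean_space set \<Rightarrow> real" where
  "outer_radius L = (SUP y\<in>L. norm y)"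

definition orthonormal_basis_of :: "'a::euclidean_space set \<Rightarrow> 'a set \<Rightarrow> bool" where
  "orthonormal_basis_of H B \<longleftrightarrow>
     B \<subseteq> H \<and> pairwise orthogonal B \<and> (\<forall>b\<in>B. norm b = 1) \<and> span B = H"

(* The law of the random vector with independent N(0,1) coordinates in an orthonormal basis of
   the subspace H, as a measure on the ambient space that is concentrated on H.  By rotation
   invariance the law does not depend on which basis is chosen. *)
definition std_gaussian_on :: "'a::euclidean_space set \<Rightarrow> 'a measure" where
  "std_gaussian_on H =
     (let B = (SOME B. orthonormal_basis_of H B)
      in distr (\<Pi>\<^sub>M b\<in>B. density lborel (\<lambda>x. ennreal (std_normal_density x))) borel
           (\<lambda>g. \<Sum>b\<in>B. g b *\<^sub>R b))"

definition ell :: "'a::euclidean_space set \<Rightarrow> 'a set \<Rightarrow> real" where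
  "ell H L = (\<integral>x. body_gauge L x \<partial>std_gaussian_on H)"

(* The Grassmannian of k-dimensional subspaces with its Borel sigma-algebra.  Its topology is the
   one induced by the embedding that sends a subspace to the matrix of the orthogonal projection
   onto it (the closest point of a subspace is the orthogonal projection). *)
definition grassmannian :: "nat \<Rightarrow> (real^'N) set measure" where
  "grassmannian k =
     vimage_algebra {E. subspace E \<and> dim E = k} (\<lambda>E. matrix (closest_point E)) borel"

(* The normalized Haar measure on the Grassmannian: the (unique) Borel probability measure that is
   invariant under the action of the orthogonal group. *)
definition haar_grassmannian :: "nat \<Rightarrow> (real^'N) set measure \<Rightarrow> bool" where
  "haar_grassmannian k \<mu> \<longleftrightarrow>
     prob_space \<mu> \<and> sets \<mu> = sets (grassmannian k) \<and>
     (\<forall>U. orthogonal_transformation U \<longrightarrow> distr \<mu> (grassmannian k) (\<lambda>E. U ` E) = \<mu>)"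

end

theory Submission
  imports Defs "HOL-Real_Asymp.Real_Asymp"
begin

text \<open>
Write \<open>L\<close> for \<open>K \<inter> F\<close>, \<open>R\<close> for the outer radius of its polar in \<open>F\<close>, and \<open>r\<close> for the bound on the random
radius.  A random subspace \<open>E\<close> of codimension \<open>n\<close> meets the \<open>(n + 1)\<close>-dimensional subspace \<open>F\<close> in at
least a line, and by invariance this intersection points in a uniformly distributed direction of \<open>F\<close>.
A uniform direction is that of a Gaussian vector \<open>G\<close> in \<open>F\<close>.  If \<open>E\<close> contains \<open>G\<close> then \<open>E \<inter> K\<close> contains
the multiple of \<open>G\<close> with gauge one, whose norm is \<open>norm G / body_gauge L G\<close>.  So it suffices that \<open>norm G\<close>
is not too small and that the gauge of \<open>G\<close> is not too large.

\<^item> \<open>norm G \<le> sqrt n / 2\<close> has probability at most \<open>exp (- n / 8)\<close>: this is a Chernoff bound for a sum of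
  \<open>n + 1\<close> independent squares (\<open>gaussian_small_ball\<close>).

\<^item> The gauge is \<open>R\<close>-Lipschitz on \<open>F\<close> by the bipolar theorem (\<open>gauge_ext_lipschitz\<close>), so it exceeds its mean by
  \<open>t * R\<close> with probability at most \<open>exp (- t\<^sup>2 / 2)\<close> by Gaussian concentration (\<open>gaussian_concentration\<close>).

The sharp constant in the concentration inequality comes from the dual form of Talagrand's transport
inequality: if \<open>g y - f x \<le> (norm (y - x))\<^sup>2 / 2\<close> for all \<open>x\<close> and \<open>y\<close>, then the Gaussian mean of \<open>exp g\<close> is at
most the exponential of the mean of \<open>f\<close>.  On the line this follows from the monotone map that transports
the Gaussian measure to the measure with density proportional to \<open>exp g\<close> (\<open>transport_inequality_real\<close>).
The inequality is stable under products because the hypothesis splits by Pythagoras' theorem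
(\<open>gaussian_transport\<close>).

The claim about uniform directions is used in the following form (\<open>haar_meets\<close>): if \<open>D\<close> is a compact set of
directions in \<open>F\<close>, then \<open>E\<close> meets \<open>D\<close> with at least the probability that the direction of \<open>G\<close> lies in \<open>D\<close>.
The proof avoids a measurable selection of a point of \<open>E \<inter> F\<close>: a direction \<open>y\<close> is picked at random near
\<open>E \<inter> F\<close>, with a density normalised for each \<open>E\<close>; by invariance the density averages over \<open>E\<close> to a
constant, so that \<open>y\<close> is again distributed as the direction of \<open>G\<close>.
\<close>

section \<open>The transport inequality on the line\<close>

abbreviation std_normal :: "real measure" where
  "std_normal \<equiv> density lborel (\<lambda>x. ennreal (std_normal_density x))"

lemma prob_space_std_normal: "prob_space std_normal"
  by (rule prob_space_normal_density) simp

lemma DERIV_std_normal_density: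
  "(std_normal_density has_real_derivative - x * std_normal_density x) (at x)"
  unfolding std_normal_density_def[abs_def]
  by (auto intro!: derivative_eq_intros simp: field_simps)

lemma continuous_on_std_normal_density: "continuous_on A std_normal_density"
  using DERIV_std_normal_density DERIV_isCont continuous_at_imp_continuous_on by blast

text \<open>
Exponential moments of the Gaussian reduce to the total mass of a shifted normal density.
\<close>

lemma std_normal_exp_shift:
  "exp (c * x) * std_normal_density x = exp (c\<^sup>2 / 2) * normal_density c 1 x"
  by (simp add: std_normal_density_def normal_density_def mult_exp_exp power2_eq_square field_simps)

lemma integrable_exp_abs_std_normal:
  "integrable lborel (\<lambda>x. exp (c * \<bar>x\<bar>) * std_normal_density x)"
proof (rule Bochner_Integration.integrable_bound)
  show "integrable lborel (\<lambda>x. exp (c\<^sup>2 / 2) * normal_density c 1 x + exp ((-c)\<^sup>2 / 2) * normal_density (-c) 1 x)"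
    by (intro Bochner_Integration.integrable_add integrable_mult_right) auto
  have "exp (c * \<bar>x\<bar>) * std_normal_density x \<le> exp (c * x) * std_normal_density x + exp ((-c) * x) * std_normal_density x" for x
    by (cases "x \<ge> 0") (auto simp: )
  then show "AE x in lborel. norm (exp (c * \<bar>x\<bar>) * std_normal_density x)
     \<le> norm (exp (c\<^sup>2 / 2) * normal_density c 1 x + exp ((-c)\<^sup>2 / 2) * normal_density (-c) 1 x)"
    by (intro AE_I2) (simp only: std_normal_exp_shift, simp add: add_nonneg_nonneg)
qed measurable

lemma integrable_std_normal_iff:
  fixes f :: "real \<Rightarrow> real"
  assumes "f \<in> borel_measurable borel"
  shows "integrable std_normal f \<longleftrightarrow> integrable lborel (\<lambda>x. f x * std_normal_density x)"
  using assms by (subst integrable_density) (auto simp: mult.commute)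

lemma integral_std_normal:
  fixes f :: "real \<Rightarrow> real"
  assumes "f \<in> borel_measurable borel"
  shows "(\<integral>x. f x \<partial>std_normal) = (\<integral>x. f x * std_normal_density x \<partial>lborel)"
  using assms by (subst integral_density) (auto simp: mult.commute)

text \<open>
The distribution function of a measure with a positive continuous density is a differentiable bijection onto
the open unit interval.  Composing one such function with the inverse of another gives the transport map.
\<close>

lemma cdf_of_continuous_density:
  fixes p :: "real \<Rightarrow> real"
  assumes cont: "continuous_on UNIV p" and pos: "\<And>x. 0 < p x"
    and int: "integrable lborel p" and one: "(\<integral>x. p x \<partial>lborel) = 1"
  defines "\<nu> \<equiv> density lborel (\<lambda>x. ennreal (p x))"
  shows "real_distribution \<nu>"
    and "(cdf \<nu> has_real_derivative p x) (at x)"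
    and "strict_mono (cdf \<nu>)"
    and "0 < cdf \<nu> x" and "cdf \<nu> x < 1"
    and "\<And>u. 0 < u \<Longrightarrow> u < 1 \<Longrightarrow> \<exists>y. cdf \<nu> y = u"
    and "a \<le> b \<Longrightarrow> (p has_integral (cdf \<nu> b - cdf \<nu> a)) {a..b}"
proof -
  have m[measurable]: "p \<in> borel_measurable borel"
    using cont by (rule borel_measurable_continuous_onI)
  have "emeasure \<nu> (space \<nu>) = 1"
    unfolding \<nu>_def using one nn_integral_eq_integral[OF int] pos
    by (simp add: emeasure_density less_imp_le)
  then interpret prob_space \<nu> by (rule prob_spaceI)
  show rd: "real_distribution \<nu>"
    by unfold_locales (simp_all add: \<nu>_def)
  then interpret real_distribution \<nu> .
  have diff: "(p has_integral (cdf \<nu> b - cdf \<nu> a)) {a..b}" if "a \<le> b" for a b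
  proof -
    have "cdf \<nu> b - cdf \<nu> a = measure \<nu> {a<..b}"
      using that by (cases "a = b") (auto simp: cdf_diff_eq)
    also have "\<dots> = (LINT x:{a<..b}|lborel. p x)"
    proof -
      have "measure \<nu> {a<..b} = (\<integral>x. indicator {a<..b} x \<partial>\<nu>)" by simp
      also have "\<dots> = (\<integral>x. p x *\<^sub>R indicator {a<..b} x \<partial>lborel)"
        unfolding \<nu>_def using pos by (intro integral_density) (auto simp: less_imp_le)
      finally show ?thesis by (simp add: set_lebesgue_integral_def mult.commute)
    qed
    also have "\<dots> = (LINT x:{a..b}|lborel. p x)"
    proof (unfold set_lebesgue_integral_def, rule integral_cong_AE)
      show "AE x in lborel. indicat_real {a<..b} x *\<^sub>R p x = indicat_real {a..b} x *\<^sub>R p x"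
        using AE_lborel_singleton[of a] by eventually_elim (auto simp: indicator_def)
    qed measurable
    finally have "cdf \<nu> b - cdf \<nu> a = (LINT x:{a..b}|lborel. p x)" .
    moreover have "set_integrable lborel {a..b} p"
      unfolding set_integrable_def using int by (intro integrable_mult_indicator) auto
    ultimately show ?thesis 
      by (metis has_integral_iff set_borel_integral_eq_integral)
  qed
  then show "a \<le> b \<Longrightarrow> (p has_integral (cdf \<nu> b - cdf \<nu> a)) {a..b}" .
  have der: "(cdf \<nu> has_real_derivative p x) (at x)" for x
  proof -
    have "((\<lambda>u. integral {x-1..u} p) has_real_derivative p x) (at x within {x-1..x+1})"
      by (rule integral_has_real_derivative) (auto intro: continuous_on_subset[OF cont])
    then have "((\<lambda>u. integral {x-1..u} p + cdf \<nu> (x-1)) has_real_derivative p x) (at x within {x-1<..<x+1})"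
      by (auto intro!: derivative_eq_intros intro: DERIV_subset)
    then have der0: "((\<lambda>u. integral {x-1..u} p + cdf \<nu> (x-1)) has_real_derivative p x) (at x)"
      by (subst (asm) at_within_open) auto
    have "cdf \<nu> u = integral {x-1..u} p + cdf \<nu> (x-1)" if "u \<in> {x-1<..<x+1}" for u
      using integral_unique[OF diff[of "x-1" u]] that by simp
    then have ev: "\<forall>\<^sub>F u in nhds x. cdf \<nu> u = integral {x-1..u} p + cdf \<nu> (x-1)"
      by (intro eventually_mono[OF eventually_nhds_in_open[of "{x-1<..<x+1}"]]) auto
    then show ?thesis
      using der0 DERIV_cong_ev[OF refl ev refl] by simp
  qed
  then show "(cdf \<nu> has_real_derivative p x) (at x)" .
  show sm: "strict_mono (cdf \<nu>)"
    by (rule strict_monoI, rule DERIV_pos_imp_increasing) (use der pos in blast)+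
  show "0 < cdf \<nu> x"
    using strict_monoD[OF sm, of "x-1" x] cdf_nonneg[of "x-1"] by simp
  show "cdf \<nu> x < 1"
    using strict_monoD[OF sm, of x "x+1"] cdf_bounded_prob[of "x+1"] by simp
  show "\<exists>y. cdf \<nu> y = u" if u: "0 < u" "u < 1" for u
  proof -
    obtain a where a: "cdf \<nu> a < u"
      using order_tendstoD(2)[OF cdf_lim_at_bot u(1)] by (meson eventually_at_bot_linorder order_refl)
    obtain b where b: "u < cdf \<nu> b"
      using order_tendstoD(1)[OF cdf_lim_at_top_prob u(2)] by (meson eventually_at_top_linorder order_refl)
    have "a \<le> b" using a b sm by (metis less_trans linorder_le_less_linear not_less_iff_gr_or_eq strict_monoD)
    then show ?thesis
      using IVT[of "cdf \<nu>" a u b] a b der DERIV_isCont by (metis less_imp_le)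
  qed
qed

text \<open>
Let \<open>\<nu>\<close> be the probability measure with density \<open>exp g / Z\<close> relative to the standard Gaussian, and \<open>T\<close> the
increasing map from the Gaussian to \<open>\<nu>\<close>.  The change of variables formula for \<open>T\<close> gives
\<open>ln Z = ln (T' x) + x\<^sup>2 / 2 + g (T x) - (T x)\<^sup>2 / 2\<close>.  Bounding \<open>ln (T' x)\<close> by \<open>T' x - 1\<close> and \<open>g (T x)\<close> by
\<open>f x + (T x - x)\<^sup>2 / 2\<close> yields \<open>ln Z \<le> f x + T' x - 1 - x * (T x - x)\<close>.  Multiplied by the Gaussian density,
everything on the right except \<open>f x\<close> is the derivative of \<open>(T x - x) * std_normal_density x\<close>, which
vanishes at infinity.
\<close>

lemma transport_inequality_real:
  fixes f g :: "real \<Rightarrow> real"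
  assumes f: "continuous_on UNIV f" "integrable std_normal f"
    and g: "continuous_on UNIV g" "\<And>y. g y \<le> A + B * \<bar>y\<bar>"
    and fg: "\<And>x y. g y - f x \<le> (y - x)\<^sup>2 / 2"
  shows "(\<integral>y. exp (g y) \<partial>std_normal) \<le> exp (\<integral>x. f x \<partial>std_normal)"
proof -
  let ?\<phi> = std_normal_density
  have \<phi>pos: "0 < ?\<phi> x" for x by (simp add: normal_density_pos)
  have mg[measurable]: "g \<in> borel_measurable borel" "f \<in> borel_measurable borel"
    using f g by (auto intro: borel_measurable_continuous_onI)
  define Z where "Z = (\<integral>y. exp (g y) * ?\<phi> y \<partial>lborel)"
  have Zeq: "(\<integral>y. exp (g y) \<partial>std_normal) = Z"
    unfolding Z_def by (rule integral_std_normal) measurable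
  (* The factor 1 + y^2 is there because the decay of H below needs the second moment of \<nu>. *)
  have bnd: "exp (g y) * (1 + y\<^sup>2) \<le> 2 * exp A * exp ((B + 2) * \<bar>y\<bar>)" for y
  proof -
    have "1 + y\<^sup>2 \<le> 2 * exp (2 * \<bar>y\<bar>)"
    proof -
      have "\<bar>y\<bar> \<le> exp \<bar>y\<bar>" using exp_ge_add_one_self[of "\<bar>y\<bar>"] by linarith
      then have "\<bar>y\<bar>^2 \<le> exp \<bar>y\<bar> ^2" by (intro power_mono) auto
      then have "y\<^sup>2 \<le> exp (2 * \<bar>y\<bar>)" by (simp add: exp_double)
      moreover have "1 \<le> exp (2 * \<bar>y\<bar>)" by simp
      ultimately show ?thesis by linarith
    qed
    moreover have "exp (g y) \<le> exp A * exp (B * \<bar>y\<bar>)"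
      using g(2)[of y] by (simp add: exp_add[symmetric])
    ultimately have "exp (g y) * (1 + y\<^sup>2) \<le> (exp A * exp (B * \<bar>y\<bar>)) * (2 * exp (2 * \<bar>y\<bar>))"
      by (intro mult_mono) auto
    also have "\<dots> = 2 * exp A * exp ((B + 2) * \<bar>y\<bar>)"
      by (simp add: exp_add distrib_right)
    finally show ?thesis .
  qed
  have int2: "integrable lborel (\<lambda>y. (exp (g y) * (1 + y\<^sup>2)) * ?\<phi> y)"
  proof (rule Bochner_Integration.integrable_bound)
    show "integrable lborel (\<lambda>y. 2 * exp A * (exp ((B + 2) * \<bar>y\<bar>) * ?\<phi> y))"
      by (intro integrable_mult_right integrable_exp_abs_std_normal)
    show "AE y in lborel. norm (exp (g y) * (1 + y\<^sup>2) * ?\<phi> y)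
        \<le> norm (2 * exp A * (exp ((B + 2) * \<bar>y\<bar>) * ?\<phi> y))"
      using mult_right_mono[OF bnd less_imp_le[OF \<phi>pos]]
      by (intro AE_I2) (simp add: abs_mult mult.assoc add_nonneg_nonneg)
  qed measurable
  have int0: "integrable lborel (\<lambda>y. exp (g y) * ?\<phi> y)"
  proof (rule Bochner_Integration.integrable_bound[OF int2])
    show "AE y in lborel. norm (exp (g y) * ?\<phi> y) \<le> norm (exp (g y) * (1 + y\<^sup>2) * ?\<phi> y)"
      by (intro AE_I2) (auto simp: abs_mult add_nonneg_nonneg distrib_right distrib_left)
  qed measurable
  have Zpos: "0 < Z"
  proof -
    have "0 \<le> Z" unfolding Z_def by (intro integral_nonneg_AE) (auto simp: )
    moreover have "Z \<noteq> 0"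
    proof
      assume "Z = 0"
      then have "AE y in lborel. exp (g y) * ?\<phi> y = 0"
        unfolding Z_def using integral_nonneg_eq_0_iff_AE[OF int0] by auto
      then have "AE y in (lborel :: real measure). False"
        by eventually_elim (use \<phi>pos in \<open>auto simp: less_le\<close>)
      then show False by (simp add: eventually_False ae_filter_eq_bot_iff)
    qed
    ultimately show ?thesis by simp
  qed
  define p where "p y = exp (g y) * ?\<phi> y / Z" for y
  have p: "continuous_on UNIV p" "\<And>y. 0 < p y" "integrable lborel p" "(\<integral>y. p y \<partial>lborel) = 1"
    unfolding p_def using Zpos \<phi>pos int0
    by (auto intro!: continuous_intros g continuous_on_std_normal_density simp: Z_def[symmetric])
  have q: "continuous_on UNIV ?\<phi>" "\<And>y. 0 < ?\<phi> y" "integrable lborel ?\<phi>" "(\<integral>y. ?\<phi> y \<partial>lborel) = 1"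
    using \<phi>pos by (auto intro!: continuous_on_std_normal_density)
  note P = cdf_of_continuous_density[OF p] and Q = cdf_of_continuous_density[OF q]
  define \<nu> where "\<nu> = density lborel (\<lambda>x. ennreal (p x))"
  define F where "F = cdf \<nu>"
  define \<Phi> where "\<Phi> = cdf std_normal"
  define G where "G u = (SOME y. F y = u)" for u
  have FG: "F (G u) = u" if "0 < u" "u < 1" for u
    unfolding G_def F_def \<nu>_def using P(6)[OF that] by (rule someI_ex)
  have GF: "G (F y) = y" for y
    using FG[of "F y"] P(4,5)[of y] strict_mono_eq[OF P(3)] by (simp add: F_def \<nu>_def)
  define T where "T x = G (\<Phi> x)" for x
  have \<Phi>01: "0 < \<Phi> x" "\<Phi> x < 1" for x
    using Q(4,5) by (simp_all add: \<Phi>_def)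
  have FT: "F (T x) = \<Phi> x" for x
    unfolding T_def using FG \<Phi>01 by simp
  have F': "(F has_real_derivative p y) (at y)" for y
    unfolding F_def \<nu>_def by (rule P)
  have G': "(G has_real_derivative inverse (p (G u))) (at u)" if u: "0 < u" "u < 1" for u
  proof (rule DERIV_inverse_function[OF F' _ u])
    show "p (G u) \<noteq> 0" using p(2)[of "G u"] by simp
    have "isCont G (F (G u))"
      by (rule isCont_inverse_function[of 1]) (use F' DERIV_isCont GF in auto)
    then show "isCont G u" using FG u by simp
  qed (use FG in auto)
  have T': "(T has_real_derivative ?\<phi> x / p (T x)) (at x)" for x
    unfolding T_def
    using DERIV_chain2[OF G'[OF \<Phi>01] Q(2)[of x, folded \<Phi>_def]] by (simp add: divide_inverse mult.commute)
  define L where "L = ln Z"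
  have pointwise: "(L - f x) * ?\<phi> x \<le> (?\<phi> x / p (T x) - 1 - x * (T x - x)) * ?\<phi> x" for x
  proof (rule mult_right_mono)
    have "ln (?\<phi> x / p (T x)) \<le> ?\<phi> x / p (T x) - 1"
      by (rule ln_le_minus_one) (use \<phi>pos p(2) in simp)
    moreover have "ln (?\<phi> x / p (T x)) = - x\<^sup>2 / 2 - g (T x) + (T x)\<^sup>2 / 2 + L"
      unfolding p_def L_def std_normal_density_def using Zpos
      by (simp add: ln_div ln_mult)
    moreover have "g (T x) - f x \<le> (T x - x)\<^sup>2 / 2" by (rule fg)
    moreover have "(T x - x)\<^sup>2 / 2 = (T x)\<^sup>2 / 2 - x * (T x - x) - x\<^sup>2/2"
      by (simp add: power2_eq_square field_simps)
    ultimately show "L - f x \<le> ?\<phi> x / p (T x) - 1 - x * (T x - x)" by linarith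
  qed (use \<phi>pos less_imp_le in blast)
  define H where "H x = (T x - x) * ?\<phi> x" for x
  have H': "(H has_real_derivative (?\<phi> x / p (T x) - 1 - x * (T x - x)) * ?\<phi> x) (at x)" for x
    unfolding H_def
    by (rule derivative_eq_intros T' DERIV_std_normal_density refl)+ (simp add: algebra_simps)
  have intLf: "integrable lborel (\<lambda>x. (L - f x) * ?\<phi> x)"
    using integrable_std_normal_iff[THEN iffD1, OF _ f(2)] q(3)
    by (simp add: left_diff_distrib)
  have finite_bound: "(LINT x:{-real k..real k}|lborel. (L - f x) * ?\<phi> x) \<le> H (real k) - H (- real k)" for k
  proof -
    have si: "set_integrable lborel {-real k..real k} (\<lambda>x. (L - f x) * ?\<phi> x)"
      unfolding set_integrable_def by (rule integrable_mult_indicator[OF _ intLf]) simp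
    show ?thesis
    proof (rule has_integral_le)
      show "((\<lambda>x. (L - f x) * ?\<phi> x) has_integral (LINT x:{-real k..real k}|lborel. (L - f x) * ?\<phi> x)) {-real k..real k}"
        by (metis si has_integral_iff set_borel_integral_eq_integral)
      show "((\<lambda>x. (?\<phi> x / p (T x) - 1 - x * (T x - x)) * ?\<phi> x) has_integral (H (real k) - H (- real k))) {-real k..real k}"
        by (rule fundamental_theorem_of_calculus)
          (auto intro!: DERIV_subset[OF H'] simp: has_real_derivative_iff_has_vector_derivative[symmetric])
    qed (rule pointwise)
  qed
  have lim1: "(\<lambda>k. LINT x:{-real k..real k}|lborel. (L - f x) * ?\<phi> x) \<longlonglongrightarrow> (\<integral>x. (L - f x) * ?\<phi> x \<partial>lborel)"
    unfolding set_lebesgue_integral_def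
  proof (rule integral_dominated_convergence[where w="\<lambda>x. norm ((L - f x) * ?\<phi> x)"])
    show "AE x in lborel. (\<lambda>k. indicat_real {-real k..real k} x *\<^sub>R ((L - f x) * ?\<phi> x)) \<longlonglongrightarrow> (L - f x) * ?\<phi> x"
    proof (rule AE_I2, rule tendsto_eventually)
      fix x :: real
      obtain k0 :: nat where "\<bar>x\<bar> \<le> real k0" using real_arch_simple by blast
      then show "\<forall>\<^sub>F k in sequentially. indicat_real {-real k..real k} x *\<^sub>R ((L - f x) * ?\<phi> x) = (L - f x) * ?\<phi> x"
        by (intro eventually_sequentiallyI[of k0]) (auto simp: indicator_def abs_le_iff)
    qed
  qed (use intLf in \<open>auto simp: indicator_def\<close>)
  define M2 where "M2 = (\<integral>y. y\<^sup>2 * p y \<partial>lborel)"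
  have intM2: "integrable lborel (\<lambda>y. y\<^sup>2 * p y)"
  proof (rule Bochner_Integration.integrable_bound[OF integrable_divide[OF int2, of Z]])
    show "AE y in lborel. norm (y\<^sup>2 * p y) \<le> norm (exp (g y) * (1 + y\<^sup>2) * ?\<phi> y / Z)"
      unfolding p_def using Zpos \<phi>pos
      by (intro AE_I2) (auto simp: abs_mult add_nonneg_nonneg field_simps intro!: mult_right_mono)
  qed (simp add: p_def)
  interpret \<nu>: real_distribution \<nu> unfolding \<nu>_def by (rule P)
  interpret N: real_distribution std_normal by (rule Q)
  have markov: "c\<^sup>2 * measure \<nu> S \<le> M2" if S[measurable]: "S \<in> sets borel" and c: "\<And>y. y \<in> S \<Longrightarrow> c\<^sup>2 \<le> y\<^sup>2" for S c
  proof -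
    have "c\<^sup>2 * measure \<nu> S = c\<^sup>2 * (\<integral>y. indicat_real S y \<partial>\<nu>)" by (simp add: \<nu>_def)
    also have "(\<integral>y. indicat_real S y \<partial>\<nu>) = (\<integral>y. p y *\<^sub>R indicat_real S y \<partial>lborel)"
      unfolding \<nu>_def using p(2) by (intro integral_density) (auto simp: less_imp_le p_def[abs_def])
    also have "c\<^sup>2 * \<dots> = (\<integral>y. c\<^sup>2 * (p y *\<^sub>R indicat_real S y) \<partial>lborel)" by simp
    also have "\<dots> \<le> M2" unfolding M2_def
    proof (rule integral_mono[OF _ intM2])
      show "integrable lborel (\<lambda>y. c\<^sup>2 * (p y *\<^sub>R indicat_real S y))"
        using integrable_mult_indicator[OF S[folded sets_lborel] p(3)]
        by (intro integrable_mult_right) (simp add: mult.commute)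
      show "c\<^sup>2 * (p y *\<^sub>R indicat_real S y) \<le> y\<^sup>2 * p y" for y
        using c[of y] p(2)[of y] by (auto simp: indicator_def less_imp_le intro!: mult_right_mono)
    qed
    finally show ?thesis .
  qed
  have normal_tail: "?\<phi> (\<bar>x\<bar> + 1) \<le> \<Phi> x" "?\<phi> (\<bar>x\<bar> + 1) \<le> 1 - \<Phi> x" for x
  proof -
    have lower: "?\<phi> (\<bar>x\<bar> + 1) \<le> ?\<phi> u" if "\<bar>u\<bar> \<le> \<bar>x\<bar> + 1" for u
    proof -
      have "u\<^sup>2 \<le> (\<bar>x\<bar> + 1)\<^sup>2" using that by (simp add: abs_le_square_iff[symmetric])
      then show ?thesis by (simp add: std_normal_density_def divide_right_mono)
    qed
    have "?\<phi> (\<bar>x\<bar> + 1) \<le> \<Phi> b - \<Phi> a" if "b = a + 1" "\<bar>a\<bar> \<le> \<bar>x\<bar> + 1" "\<bar>b\<bar> \<le> \<bar>x\<bar> + 1" for a b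
    proof (rule has_integral_le[where f="\<lambda>_. ?\<phi> (\<bar>x\<bar> + 1)" and S="{a..b}"])
      show "((\<lambda>_. ?\<phi> (\<bar>x\<bar> + 1)) has_integral ?\<phi> (\<bar>x\<bar> + 1)) {a..b}"
        using has_integral_const_real[of "?\<phi> (\<bar>x\<bar> + 1)" a b] that by simp
      show "(?\<phi> has_integral \<Phi> b - \<Phi> a) {a..b}"
        unfolding \<Phi>_def using Q(7)[of a b] that by simp
    qed (use that in \<open>auto intro!: lower\<close>)
    from this[of x "x-1"] this[of "x+1" x] show "?\<phi> (\<bar>x\<bar> + 1) \<le> \<Phi> x" "?\<phi> (\<bar>x\<bar> + 1) \<le> 1 - \<Phi> x"
      using \<Phi>01[of "x-1"] \<Phi>01[of "x+1"] by linarith+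
  qed
  (* Markov's inequality for the second moment, applied to the tail of \<nu> beyond T x; that tail has
    the same mass as the Gaussian tail beyond x. *)
  have growth: "(T x)\<^sup>2 * ?\<phi> (\<bar>x\<bar> + 1) \<le> M2" for x
  proof (cases "T x \<le> 0")
    case True
    have "(T x)\<^sup>2 * ?\<phi> (\<bar>x\<bar> + 1) \<le> (T x)\<^sup>2 * measure \<nu> {..T x}"
      using normal_tail(1)[of x] FT[of x] by (intro mult_left_mono) (auto simp: F_def cdf_def)
    also have "\<dots> \<le> M2"
      by (rule markov) (use True in \<open>auto simp: abs_le_square_iff[symmetric]\<close>)
    finally show ?thesis .
  next
    case False
    have "measure \<nu> {T x<..} = 1 - F (T x)"
      unfolding F_def cdf_def using \<nu>.prob_compl[of "{..T x}"]
      by (simp add: \<nu>_def Compl_eq_Diff_UNIV[symmetric] del: Compl_eq_Diff_UNIV)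
    then have "(T x)\<^sup>2 * ?\<phi> (\<bar>x\<bar> + 1) \<le> (T x)\<^sup>2 * measure \<nu> {T x<..}"
      using normal_tail(2)[of x] FT[of x] by (intro mult_left_mono) auto
    also have "\<dots> \<le> M2"
      by (rule markov) (use False in \<open>auto simp: abs_le_square_iff[symmetric]\<close>)
    finally show ?thesis .
  qed
  (* By the growth bound T x is at most of the order of exp ((x + 1)^2 / 4) for x > 0, which the
    factor exp (- x^2 / 2) in H beats. *)
  define e where "e r = (sqrt (M2 / ?\<phi> (r + 1)) + r) * ?\<phi> r" for r
  have Hle: "\<bar>H x\<bar> \<le> e \<bar>x\<bar>" for x
  proof -
    have "\<bar>T x\<bar> = sqrt ((T x)\<^sup>2)" by simp
    also have "\<dots> \<le> sqrt (M2 / ?\<phi> (\<bar>x\<bar> + 1))"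
      using growth[of x] \<phi>pos[of "\<bar>x\<bar> + 1"] by (intro real_sqrt_le_mono) (simp add: pos_le_divide_eq)
    finally have "\<bar>T x - x\<bar> \<le> sqrt (M2 / ?\<phi> (\<bar>x\<bar> + 1)) + \<bar>x\<bar>" by linarith
    then have "\<bar>T x - x\<bar> * ?\<phi> x \<le> (sqrt (M2 / ?\<phi> (\<bar>x\<bar> + 1)) + \<bar>x\<bar>) * ?\<phi> x"
      by (rule mult_right_mono) simp
    moreover have "?\<phi> \<bar>x\<bar> = ?\<phi> x" by (simp add: std_normal_density_def)
    ultimately show ?thesis by (simp add: H_def e_def abs_mult)
  qed
  have e_lim: "(\<lambda>k. e (real k)) \<longlonglongrightarrow> 0"
  proof -
    have e_eq: "e r = (sqrt M2 / sqrt (1 / sqrt (2*pi)) / sqrt (2*pi)) * (exp ((r+1)\<^sup>2 / 4) * exp (- r\<^sup>2 / 2))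
        + (1 / sqrt (2*pi)) * (r * exp (- r\<^sup>2 / 2))" for r
    proof -
      have "sqrt (exp (- (r+1)\<^sup>2 / 2)) = exp (- (r+1)\<^sup>2 / 4)"
        by (rule real_sqrt_unique) (simp_all add: power2_eq_square mult_exp_exp)
      then show ?thesis
        unfolding e_def std_normal_density_def
        by (simp add: real_sqrt_divide real_sqrt_mult exp_minus field_simps)
    qed
    have u: "(\<lambda>k. exp ((real k+1)\<^sup>2 / 4) * exp (- (real k)\<^sup>2 / 2)) \<longlonglongrightarrow> 0"
      by real_asymp
    have v: "(\<lambda>k. real k * exp (- (real k)\<^sup>2 / 2)) \<longlonglongrightarrow> 0"
      by real_asymp
    show ?thesis unfolding e_eq
      by (rule tendsto_add_zero[OF tendsto_mult_right_zero[OF u] tendsto_mult_right_zero[OF v]])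
  qed
  have lim2: "(\<lambda>k. H (real k) - H (- real k)) \<longlonglongrightarrow> 0"
  proof (rule Lim_null_comparison)
    show "\<forall>\<^sub>F k in sequentially. norm (H (real k) - H (- real k)) \<le> 2 * e (real k)"
    proof (rule always_eventually, rule allI)
      fix k show "norm (H (real k) - H (- real k)) \<le> 2 * e (real k)"
        using Hle[of "real k"] Hle[of "- real k"] abs_triangle_ineq4[of "H (real k)" "H (- real k)"] by simp
    qed
    show "(\<lambda>k. 2 * e (real k)) \<longlonglongrightarrow> 0"
      using tendsto_mult_right_zero[OF e_lim] by simp
  qed
  have "(\<integral>x. (L - f x) * ?\<phi> x \<partial>lborel) \<le> 0"
    by (rule LIMSEQ_le[OF lim1 lim2]) (use finite_bound in auto)
  moreover have "(\<integral>x. (L - f x) * ?\<phi> x \<partial>lborel) = L - (\<integral>x. f x \<partial>std_normal)"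
    using integrable_std_normal_iff[THEN iffD1, OF _ f(2)] q(3,4) integral_std_normal[of f]
    by (simp add: left_diff_distrib)
  ultimately have "L \<le> (\<integral>x. f x \<partial>std_normal)" by simp
  then have "exp L \<le> exp (\<integral>x. f x \<partial>std_normal)" by simp
  then show ?thesis using Zeq Zpos by (simp add: L_def)
qed

section \<open>Concentration of Lipschitz functions of a Gaussian vector\<close>

definition gauss_coords :: "'a set \<Rightarrow> ('a \<Rightarrow> real) measure" where
  "gauss_coords B = (\<Pi>\<^sub>M b\<in>B. std_normal)"

definition vec_of :: "'a::real_vector set \<Rightarrow> ('a \<Rightarrow> real) \<Rightarrow> 'a" where
  "vec_of B \<omega> = (\<Sum>b\<in>B. \<omega> b *\<^sub>R b)"

definition orthonormal :: "'a::real_inner set \<Rightarrow> bool" where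
  "orthonormal B \<longleftrightarrow> finite B \<and> pairwise orthogonal B \<and> (\<forall>b\<in>B. norm b = 1)"

lemma product_prob_space_std_normal: "product_prob_space (\<lambda>_. std_normal)"
  by (intro product_prob_spaceI prob_space_std_normal)

lemma prob_space_gauss_coords: "prob_space (gauss_coords B)"
  unfolding gauss_coords_def by (intro prob_space_PiM prob_space_std_normal)

lemma measurable_vec_of[measurable]:
  fixes B :: "'a::euclidean_space set"
  shows "vec_of B \<in> gauss_coords B \<rightarrow>\<^sub>M borel"
proof -
  have "(\<lambda>\<omega>. \<omega> b) \<in> borel_measurable (\<Pi>\<^sub>M b\<in>B. std_normal)" if "b \<in> B" for b
    using measurable_component_singleton[OF that, of "\<lambda>_. std_normal"]
    by (simp cong: measurable_cong_sets)
  then show ?thesis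
    unfolding vec_of_def[abs_def] gauss_coords_def by measurable
qed

lemma vec_of_in_span: "vec_of B \<omega> \<in> span B"
  unfolding vec_of_def by (intro span_sum span_scale span_base)

lemma vec_of_insert:
  assumes "finite B" "b \<notin> B"
  shows "vec_of (insert b B) (fun_upd \<omega> b s) = vec_of B \<omega> + s *\<^sub>R b"
  using assms by (auto simp: vec_of_def intro!: sum.cong)

text \<open>
Pythagoras: the coordinates are taken in an orthonormal system.
\<close>

lemma norm_vec_of:
  assumes "orthonormal B"
  shows "(norm (vec_of B \<omega>))\<^sup>2 = (\<Sum>b\<in>B. (\<omega> b)\<^sup>2)"
proof -
  have "(norm (vec_of B \<omega>))\<^sup>2 = (\<Sum>b\<in>B. (norm (\<omega> b *\<^sub>R b))\<^sup>2)"
    unfolding vec_of_def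
    using assms by (intro norm_sum_Pythagorean) (auto simp: orthonormal_def pairwise_def orthogonal_def)
  also have "\<dots> = (\<Sum>b\<in>B. (\<omega> b)\<^sup>2)"
    using assms by (intro sum.cong) (auto simp: orthonormal_def)
  finally show ?thesis .
qed

lemma integrable_exp_norm_gauss:
  fixes B :: "'a::euclidean_space set"
  assumes B: "orthonormal B" and "0 \<le> c"
  shows "integrable (gauss_coords B) (\<lambda>\<omega>. exp (c * norm (vec_of B \<omega>)))"
proof (rule Bochner_Integration.integrable_bound)
  interpret product_prob_space "\<lambda>_::'a. std_normal" by (rule product_prob_space_std_normal)
  have fin: "finite B" using B by (simp add: orthonormal_def)
  have "integrable std_normal (\<lambda>x. exp (c * \<bar>x\<bar>))"
    using integrable_exp_abs_std_normal by (subst integrable_std_normal_iff) auto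
  then show "integrable (gauss_coords B) (\<lambda>\<omega>. \<Prod>b\<in>B. exp (c * \<bar>\<omega> b\<bar>))"
    unfolding gauss_coords_def by (intro product_integrable_prod fin)
  have "norm (vec_of B \<omega>) \<le> (\<Sum>b\<in>B. \<bar>\<omega> b\<bar>)" for \<omega>
    using norm_sum[of "\<lambda>b. \<omega> b *\<^sub>R b" B] B by (simp add: vec_of_def orthonormal_def)
  then have "exp (c * norm (vec_of B \<omega>)) \<le> (\<Prod>b\<in>B. exp (c * \<bar>\<omega> b\<bar>))" for \<omega>
    using \<open>0 \<le> c\<close> by (simp add: exp_sum[OF fin, symmetric] sum_distrib_left[symmetric] mult_left_mono)
  then show "AE \<omega> in gauss_coords B. norm (exp (c * norm (vec_of B \<omega>))) \<le> norm (\<Prod>b\<in>B. exp (c * \<bar>\<omega> b\<bar>))"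
    by (intro AE_I2) (simp add: abs_prod)
qed measurable

lemma lipschitz_linear_growth:
  fixes f :: "'a::real_normed_vector \<Rightarrow> real"
  assumes "L-lipschitz_on UNIV f"
  shows "\<bar>f x\<bar> \<le> \<bar>f 0\<bar> + L * norm x"
  using lipschitz_onD[OF assms, of x 0] by (simp add: dist_real_def)

lemma lipschitz_integrable_gauss:
  fixes B :: "'a::euclidean_space set" and f :: "'a \<Rightarrow> real"
  assumes B: "orthonormal B" and f: "L-lipschitz_on UNIV f"
  shows "integrable (gauss_coords B) (\<lambda>\<omega>. f (vec_of B \<omega>))"
    and "integrable (gauss_coords B) (\<lambda>\<omega>. exp (f (vec_of B \<omega>)))"
proof -
  have L: "0 \<le> L" using f lipschitz_on_nonneg by blast
  have [measurable]: "f \<in> borel_measurable borel"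
    using lipschitz_on_continuous_on[OF f] by (rule borel_measurable_continuous_onI)
  have int: "integrable (gauss_coords B) (\<lambda>\<omega>. exp \<bar>f 0\<bar> * exp (L * norm (vec_of B \<omega>)))"
    using integrable_exp_norm_gauss[OF B L] by simp
  have le: "\<bar>f x\<bar> \<le> exp \<bar>f 0\<bar> * exp (L * norm x)" "exp (f x) \<le> exp \<bar>f 0\<bar> * exp (L * norm x)" for x
  proof -
    have "exp \<bar>f x\<bar> \<le> exp \<bar>f 0\<bar> * exp (L * norm x)"
      using lipschitz_linear_growth[OF f, of x] by (simp add: exp_add[symmetric])
    moreover have "\<bar>f x\<bar> \<le> exp \<bar>f x\<bar>" using exp_ge_add_one_self[of "\<bar>f x\<bar>"] by linarith
    moreover have "exp (f x) \<le> exp \<bar>f x\<bar>" by simp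
    ultimately show "\<bar>f x\<bar> \<le> exp \<bar>f 0\<bar> * exp (L * norm x)" "exp (f x) \<le> exp \<bar>f 0\<bar> * exp (L * norm x)"
      by linarith+
  qed
  show "integrable (gauss_coords B) (\<lambda>\<omega>. f (vec_of B \<omega>))"
    by (rule Bochner_Integration.integrable_bound[OF int]) (use le in auto)
  show "integrable (gauss_coords B) (\<lambda>\<omega>. exp (f (vec_of B \<omega>)))"
    by (rule Bochner_Integration.integrable_bound[OF int]) (use le in auto)
qed

lemma orthonormal_insertD:
  assumes "orthonormal (insert b B)" "b \<notin> B"
  shows "orthonormal B" "orthonormal {b}" "x \<in> span B \<Longrightarrow> x \<bullet> b = 0"
proof -
  show "orthonormal B" "orthonormal {b}"
    using assms by (auto simp: orthonormal_def pairwise_insert)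
  show "x \<bullet> b = 0" if "x \<in> span B"
    using that
  proof (induction rule: span_induct)
    case (step x) then show ?case
      using assms by (auto simp: orthonormal_def pairwise_insert orthogonal_def inner_commute)
  qed (auto simp: subspace_def inner_left_distrib)
qed

lemma gauss_coords_insert:
  fixes B :: "'a::euclidean_space set" and h :: "'a \<Rightarrow> real"
  assumes B: "finite B" "b \<notin> B" and h[measurable]: "h \<in> borel_measurable borel"
    and int: "integrable (gauss_coords (insert b B)) (\<lambda>\<omega>. h (vec_of (insert b B) \<omega>))"
  shows "(\<integral>\<omega>. h (vec_of (insert b B) \<omega>) \<partial>gauss_coords (insert b B))
       = (\<integral>\<omega>. (\<integral>s. h (vec_of B \<omega> + s *\<^sub>R b) \<partial>std_normal) \<partial>gauss_coords B)"
proof -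
  interpret product_prob_space "\<lambda>_::'a. std_normal" by (rule product_prob_space_std_normal)
  show ?thesis
    using product_integral_insert[OF B int[unfolded gauss_coords_def]]
    by (simp add: gauss_coords_def vec_of_insert[OF B])
qed

lemma gauss_coords_empty: "(\<integral>\<omega>. h (vec_of {} \<omega>) \<partial>gauss_coords {}) = (h 0 :: real)"
  by (simp add: gauss_coords_def vec_of_def PiM_empty lebesgue_integral_count_space_finite)

lemma lipschitz_shift:
  fixes f :: "'a::real_normed_vector \<Rightarrow> real"
  assumes "L-lipschitz_on UNIV f" "norm b = 1"
  shows "L-lipschitz_on UNIV (\<lambda>s. f (x + s *\<^sub>R b))" "L-lipschitz_on UNIV (\<lambda>y. f (y + v))"
proof -
  have L: "0 \<le> L" using assms(1) lipschitz_on_nonneg by blast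
  have "dist (f (x + s *\<^sub>R b)) (f (x + t *\<^sub>R b)) \<le> L * dist s t" for s t
    using lipschitz_onD[OF assms(1), of "x + s *\<^sub>R b" "x + t *\<^sub>R b"] assms(2)
    by (simp add: dist_norm scaleR_left_diff_distrib[symmetric])
  then show "L-lipschitz_on UNIV (\<lambda>s. f (x + s *\<^sub>R b))"
    using L by (intro lipschitz_onI) auto
  have "dist (f (y + v)) (f (z + v)) \<le> L * dist y z" for y z
    using lipschitz_onD[OF assms(1), of "y + v" "z + v"] by simp
  then show "L-lipschitz_on UNIV (\<lambda>y. f (y + v))"
    using L by (intro lipschitz_onI) auto
qed

lemma lipschitz_integrable_std_normal:
  fixes f :: "real \<Rightarrow> real"
  assumes f: "L-lipschitz_on UNIV f"
  shows "integrable std_normal f" "integrable std_normal (\<lambda>s. exp (f s))"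
proof -
  interpret product_prob_space "\<lambda>_::real. std_normal" by (rule product_prob_space_std_normal)
  have B: "orthonormal {1::real}" by (simp add: orthonormal_def)
  have [measurable]: "f \<in> borel_measurable borel"
    using lipschitz_on_continuous_on[OF f] by (rule borel_measurable_continuous_onI)
  note * = lipschitz_integrable_gauss[OF B f]
  have d: "distr (Pi\<^sub>M {1::real} (\<lambda>_. std_normal)) std_normal (\<lambda>\<omega>. \<omega> 1) = std_normal"
    by (rule distr_singleton)
  have m: "(\<lambda>\<omega>. \<omega> 1) \<in> Pi\<^sub>M {1::real} (\<lambda>_. std_normal) \<rightarrow>\<^sub>M std_normal"
    by (rule measurable_component_singleton) simp
  show "integrable std_normal f"
    using *(1) by (subst d[symmetric], subst integrable_distr_eq[OF m]) (auto simp: gauss_coords_def vec_of_def)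
  show "integrable std_normal (\<lambda>s. exp (f s))"
    using *(2) by (subst d[symmetric], subst integrable_distr_eq[OF m]) (auto simp: gauss_coords_def vec_of_def)
qed

lemma integral_exp_pos_std_normal:
  fixes h :: "real \<Rightarrow> real"
  assumes "integrable std_normal (\<lambda>s. exp (h s))"
  shows "0 < (\<integral>s. exp (h s) \<partial>std_normal)"
proof -
  interpret prob_space std_normal by (rule prob_space_std_normal)
  have "0 \<le> (\<integral>s. exp (h s) \<partial>std_normal)" by (intro integral_nonneg_AE) simp
  moreover have "(\<integral>s. exp (h s) \<partial>std_normal) \<noteq> 0"
  proof
    assume "(\<integral>s. exp (h s) \<partial>std_normal) = 0"
    then have "AE s in std_normal. exp (h s) = 0"
      using integral_nonneg_eq_0_iff_AE[OF assms] by auto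
    then show False by simp
  qed
  ultimately show ?thesis by linarith
qed

text \<open>
The one-dimensional inequality tensorises.  Add a vector \<open>b\<close> to \<open>B\<close> and integrate over the coordinate along
\<open>b\<close>: let \<open>f' x\<close> be the mean of \<open>f\<close>, and \<open>exp (g' x)\<close> that of \<open>exp g\<close>, on the line through \<open>x\<close> with direction
\<open>b\<close>.  As \<open>b\<close> is orthogonal to \<open>span B\<close>, the squared distance of two points splits into the parts along and across
\<open>b\<close>.  Hence the inequality on the line turns the hypothesis on \<open>f\<close> and \<open>g\<close> into the same hypothesis on
\<open>f'\<close> and \<open>g'\<close>.  Two functions are used, and not one function and its infimal convolution, because the
hypothesis then passes through the induction without any question about measurability of an infimum.
\<close>

theorem gaussian_transport:
  fixes B :: "'a::euclidean_space set" and f g :: "'a \<Rightarrow> real"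
  assumes "orthonormal B" "L-lipschitz_on UNIV f" "L-lipschitz_on UNIV g"
    and "\<And>x y. x \<in> span B \<Longrightarrow> y \<in> span B \<Longrightarrow> g y - f x \<le> (norm (y - x))\<^sup>2 / 2"
  shows "(\<integral>\<omega>. exp (g (vec_of B \<omega>)) \<partial>gauss_coords B) \<le> exp (\<integral>\<omega>. f (vec_of B \<omega>) \<partial>gauss_coords B)"
proof -
  have "finite B" using assms(1) by (simp add: orthonormal_def)
  then show ?thesis using assms
  proof (induction B arbitrary: f g rule: finite_induct)
    case empty
    show ?case using empty(4)[of 0 0] by (simp add: gauss_coords_empty gauss_coords_empty[of "\<lambda>x. exp (g x)"])
  next
    case (insert b B)
    note B = orthonormal_insertD[OF insert(4,2)]
    have b: "norm b = 1" using B(2) by (simp add: orthonormal_def)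
    note f = insert(5) and g = insert(6)
    have L: "0 \<le> L" using f lipschitz_on_nonneg by blast
    have mf: "f \<in> borel_measurable borel" and mg: "(\<lambda>x. exp (g x)) \<in> borel_measurable borel"
      using lipschitz_on_continuous_on[OF f] lipschitz_on_continuous_on[OF g]
      by (auto intro!: borel_measurable_continuous_onI continuous_intros)
    define f' where "f' x = (\<integral>s. f (x + s *\<^sub>R b) \<partial>std_normal)" for x
    define g' where "g' x = ln (\<integral>s. exp (g (x + s *\<^sub>R b)) \<partial>std_normal)" for x
    note fint = lipschitz_integrable_std_normal(1)[OF lipschitz_shift(1)[OF f b]]
    note gint = lipschitz_integrable_std_normal(2)[OF lipschitz_shift(1)[OF g b]]
    have expg': "exp (g' x) = (\<integral>s. exp (g (x + s *\<^sub>R b)) \<partial>std_normal)" for x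
      unfolding g'_def by (rule exp_ln[OF integral_exp_pos_std_normal[OF gint]])
    have step: "\<bar>f (x + v) - f (y + v)\<bar> \<le> L * norm (x - y)" "\<bar>g (x + v) - g (y + v)\<bar> \<le> L * norm (x - y)" for x y v
      using lipschitz_onD[OF f, of "x + v" "y + v"] lipschitz_onD[OF g, of "x + v" "y + v"]
      by (simp_all add: dist_norm)
    interpret N: prob_space std_normal by (rule prob_space_std_normal)
    have Nprob: "N.prob UNIV = 1" using N.prob_space by simp
    have f'_le: "f' x \<le> L * norm (x - y) + f' y" for x y
    proof -
      have "f' x \<le> (\<integral>s. L * norm (x - y) + f (y + s *\<^sub>R b) \<partial>std_normal)"
        unfolding f'_def
      proof (rule integral_mono)
        show "integrable std_normal (\<lambda>s. L * norm (x - y) + f (y + s *\<^sub>R b))"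
          by (intro Bochner_Integration.integrable_add fint) simp
        show "f (x + s *\<^sub>R b) \<le> L * norm (x - y) + f (y + s *\<^sub>R b)" for s
          using step(1)[of x "s *\<^sub>R b" y] by linarith
      qed (rule fint)
      also have "\<dots> = L * norm (x - y) + f' y"
        unfolding f'_def by (subst Bochner_Integration.integral_add) (auto intro: fint simp: Nprob)
      finally show ?thesis .
    qed
    have g'_le: "g' x \<le> L * norm (x - y) + g' y" for x y
    proof -
      have "exp (g' x) \<le> (\<integral>s. exp (L * norm (x - y)) * exp (g (y + s *\<^sub>R b)) \<partial>std_normal)"
        unfolding expg'
      proof (rule integral_mono)
        show "integrable std_normal (\<lambda>s. exp (L * norm (x - y)) * exp (g (y + s *\<^sub>R b)))"
          by (intro integrable_mult_right gint)
        show "exp (g (x + s *\<^sub>R b)) \<le> exp (L * norm (x - y)) * exp (g (y + s *\<^sub>R b))" for s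
          using step(2)[of x "s *\<^sub>R b" y] unfolding exp_add[symmetric] exp_le_cancel_iff by linarith
      qed (rule gint)
      also have "\<dots> = exp (L * norm (x - y) + g' y)"
        by (simp add: expg'[symmetric] exp_add)
      finally show ?thesis by simp
    qed
    have f': "L-lipschitz_on UNIV f'"
    proof (rule lipschitz_onI[OF _ L])
      show "dist (f' x) (f' y) \<le> L * dist x y" for x y
        using f'_le[of x y] f'_le[of y x] by (simp add: dist_norm norm_minus_commute[of y x] abs_le_iff)
    qed
    have g': "L-lipschitz_on UNIV g'"
    proof (rule lipschitz_onI[OF _ L])
      show "dist (g' x) (g' y) \<le> L * dist x y" for x y
        using g'_le[of x y] g'_le[of y x] by (simp add: dist_norm norm_minus_commute[of y x] abs_le_iff)
    qed
    have "(\<integral>\<omega>. exp (g (vec_of (insert b B) \<omega>)) \<partial>gauss_coords (insert b B)) = (\<integral>\<omega>. exp (g' (vec_of B \<omega>)) \<partial>gauss_coords B)"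
      unfolding expg'
      by (rule gauss_coords_insert[OF insert(1,2) mg lipschitz_integrable_gauss(2)[OF insert(4) g]])
    also have "\<dots> \<le> exp (\<integral>\<omega>. f' (vec_of B \<omega>) \<partial>gauss_coords B)"
    proof (rule insert.IH[OF B(1) f' g'])
      fix x y assume xy: "x \<in> span B" "y \<in> span B"
      have "(\<integral>s. exp (g (y + s *\<^sub>R b) - (norm (y - x))\<^sup>2 / 2) \<partial>std_normal) \<le> exp (\<integral>s. f (x + s *\<^sub>R b) \<partial>std_normal)"
      proof (rule transport_inequality_real)
        show "continuous_on UNIV (\<lambda>s. f (x + s *\<^sub>R b))"
          using lipschitz_on_continuous_on[OF lipschitz_shift(1)[OF f b]] .
        show "continuous_on UNIV (\<lambda>s. g (y + s *\<^sub>R b) - (norm (y - x))\<^sup>2 / 2)"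
          using lipschitz_on_continuous_on[OF lipschitz_shift(1)[OF g b]] by (intro continuous_intros)
        show "g (y + s *\<^sub>R b) - (norm (y - x))\<^sup>2 / 2 \<le> \<bar>g y\<bar> + L * \<bar>s\<bar>" for s
          using lipschitz_linear_growth[OF lipschitz_shift(1)[OF g b], of y s]
            zero_le_power2[of "norm (y - x)"] by (simp, linarith)
        show "g (y + t *\<^sub>R b) - (norm (y - x))\<^sup>2 / 2 - f (x + s *\<^sub>R b) \<le> (t - s)\<^sup>2 / 2" for s t
        proof -
          have "g (y + t *\<^sub>R b) - f (x + s *\<^sub>R b) \<le> (norm ((y + t *\<^sub>R b) - (x + s *\<^sub>R b)))\<^sup>2 / 2"
            using xy span_mono[of B "insert b B"]
            by (intro insert.prems(4) span_add span_scale) (auto intro: span_base)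
          also have "(y + t *\<^sub>R b) - (x + s *\<^sub>R b) = (y - x) + (t - s) *\<^sub>R b"
            by (simp add: algebra_simps)
          also have "(norm ((y - x) + (t - s) *\<^sub>R b))\<^sup>2 = (norm (y - x))\<^sup>2 + (norm ((t - s) *\<^sub>R b))\<^sup>2"
            using B(3)[of "y - x"] xy by (intro norm_add_Pythagorean) (simp add: orthogonal_def span_diff)
          also have "(norm ((t - s) *\<^sub>R b))\<^sup>2 = (t - s)\<^sup>2" using b by simp
          finally show ?thesis by (simp add: add_divide_distrib)
        qed
      qed (rule fint)
      also have "(\<integral>s. exp (g (y + s *\<^sub>R b) - (norm (y - x))\<^sup>2 / 2) \<partial>std_normal) = exp (g' y - (norm (y - x))\<^sup>2 / 2)"
        by (simp add: exp_diff expg')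
      finally show "g' y - f' x \<le> (norm (y - x))\<^sup>2 / 2" by (simp add: f'_def)
    qed
    also have "(\<integral>\<omega>. f' (vec_of B \<omega>) \<partial>gauss_coords B) = (\<integral>\<omega>. f (vec_of (insert b B) \<omega>) \<partial>gauss_coords (insert b B))"
      unfolding f'_def
      by (rule gauss_coords_insert[symmetric, OF insert(1,2) mf lipschitz_integrable_gauss(1)[OF insert(4) f]])
    finally show ?case .
  qed
qed

text \<open>
The transport inequality for \<open>l * f\<close> and \<open>l * f - (l * L)\<^sup>2 / 2\<close> bounds the exponential moment of \<open>f\<close>, since
\<open>l * L * d \<le> d\<^sup>2 / 2 + (l * L)\<^sup>2 / 2\<close> for every distance \<open>d\<close>.  Chernoff's bound is then optimised by
\<open>l = t / L\<close>.
\<close>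

corollary gaussian_concentration:
  fixes B :: "'a::euclidean_space set" and f :: "'a \<Rightarrow> real"
  assumes B: "orthonormal B" and f: "L-lipschitz_on UNIV f" and "0 < L" "0 < t"
  shows "measure (gauss_coords B) {\<omega> \<in> space (gauss_coords B).
            f (vec_of B \<omega>) \<ge> (\<integral>\<omega>. f (vec_of B \<omega>) \<partial>gauss_coords B) + t * L} \<le> exp (- t\<^sup>2 / 2)"
proof -
  interpret prob_space "gauss_coords B" by (rule prob_space_gauss_coords)
  have [measurable]: "f \<in> borel_measurable borel"
    using lipschitz_on_continuous_on[OF f] by (rule borel_measurable_continuous_onI)
  define E where "E = (\<integral>\<omega>. f (vec_of B \<omega>) \<partial>gauss_coords B)"
  define l where "l = t / L"
  have l: "0 < l" "l * L = t" using assms by (auto simp: l_def)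
  have lf: "(l * L)-lipschitz_on UNIV (\<lambda>x. l * f x)"
    using lipschitz_on_cmult_real_nonneg[OF f, of l] l by simp
  have lg: "(l * L)-lipschitz_on UNIV (\<lambda>x. l * f x - t\<^sup>2 / 2)"
    using lipschitz_on_diff[OF lf lipschitz_on_constant[of _ "t\<^sup>2 / 2"]] by simp
  have "(\<integral>\<omega>. exp (l * f (vec_of B \<omega>) - t\<^sup>2 / 2) \<partial>gauss_coords B) \<le> exp (\<integral>\<omega>. l * f (vec_of B \<omega>) \<partial>gauss_coords B)"
  proof (rule gaussian_transport[OF B lf lg])
    fix x y
    have "l * f y - l * f x \<le> t * norm (y - x)"
      using lipschitz_onD[OF lf, of y x] l by (simp add: dist_norm)
    moreover have "0 \<le> (norm (y - x) - t)\<^sup>2" by simp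
    ultimately show "l * f y - t\<^sup>2 / 2 - l * f x \<le> (norm (y - x))\<^sup>2 / 2"
      by (simp add: power2_diff field_simps)
  qed
  then have mgf: "(\<integral>\<omega>. exp (l * f (vec_of B \<omega>)) \<partial>gauss_coords B) \<le> exp (l * E + t\<^sup>2 / 2)"
    by (simp add: exp_diff exp_add E_def pos_divide_le_eq)
  have "measure (gauss_coords B) {\<omega> \<in> space (gauss_coords B). f (vec_of B \<omega>) \<ge> E + t * L}
      \<le> exp (- l * (E + t * L)) * (\<integral>\<omega>. exp (l * f (vec_of B \<omega>)) \<partial>gauss_coords B)"
  proof -
    note int = lipschitz_integrable_gauss(2)[OF B lf]
    have "set_integrable (gauss_coords B) (space (gauss_coords B)) (\<lambda>\<omega>. exp (l * f (vec_of B \<omega>)))"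
      unfolding set_integrable_def by (rule integrable_mult_indicator[OF sets.top int])
    from Chernoff_ineq_ge[OF l(1) this sets.top, of "E + t * L"] show ?thesis
      unfolding set_integral_space[OF int] by simp
  qed
  also have "\<dots> \<le> exp (- l * (E + t * L)) * exp (l * E + t\<^sup>2 / 2)"
    using mgf by (rule mult_left_mono) simp
  also have "\<dots> = exp (- t\<^sup>2 / 2)"
    using l(2) by (simp add: mult_exp_exp distrib_left power2_eq_square mult.left_commute[of l t L])
  finally show ?thesis by (simp add: E_def)
qed

text \<open>
For a standard normal variable the mean of \<open>exp (- 3 / 2 * x\<^sup>2)\<close> is exactly \<open>1 / 2\<close>, so Markov's inequality gives the
bound \<open>exp (3 * n / 8) * (1 / 2) ^ (n + 1)\<close>.  This is below \<open>exp (- n / 8)\<close> because \<open>exp (1 / 2) \<le> 2\<close>.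
\<close>

lemma gaussian_small_ball:
  fixes B :: "'a::euclidean_space set"
  assumes B: "orthonormal B" "card B = n + 1"
  shows "measure (gauss_coords B) {\<omega> \<in> space (gauss_coords B). norm (vec_of B \<omega>) \<le> sqrt (real n) / 2} \<le> exp (- real n / 8)"
proof -
  interpret prob_space "gauss_coords B" by (rule prob_space_gauss_coords)
  interpret P: product_prob_space "\<lambda>_::'a. std_normal" by (rule product_prob_space_std_normal)
  have fin: "finite B" using B by (simp add: orthonormal_def)
  have dens: "exp (- 3 / 2 * x\<^sup>2) * std_normal_density x = (1/2) * normal_density 0 (1/2) x" for x
    by (simp add: std_normal_density_def normal_density_def mult_exp_exp power2_eq_square real_sqrt_divide real_sqrt_mult field_simps)
  have int1: "integrable std_normal (\<lambda>x. exp (- 3 / 2 * x\<^sup>2))"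
  proof -
    have "integrable lborel (\<lambda>x. exp (- 3 / 2 * x\<^sup>2) * std_normal_density x)"
      unfolding dens by simp
    then show ?thesis
      using integrable_std_normal_iff[of "\<lambda>x. exp (- 3 / 2 * x\<^sup>2)"] by simp
  qed
  have val1: "(\<integral>x. exp (- 3 / 2 * x\<^sup>2) \<partial>std_normal) = 1/2"
  proof -
    have "(\<integral>x. exp (- 3 / 2 * x\<^sup>2) * std_normal_density x \<partial>lborel) = 1/2"
      unfolding dens by simp
    then show ?thesis
      using integral_std_normal[of "\<lambda>x. exp (- 3 / 2 * x\<^sup>2)"] by simp
  qed
  have eq: "exp (- 3 / 2 * (norm (vec_of B \<omega>))\<^sup>2) = (\<Prod>b\<in>B. exp (- 3 / 2 * (\<omega> b)\<^sup>2))" for \<omega>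
    unfolding norm_vec_of[OF B(1)] by (simp add: exp_sum[OF fin, symmetric] sum_distrib_left sum_negf)
  have int: "integrable (gauss_coords B) (\<lambda>\<omega>. exp (- 3 / 2 * (norm (vec_of B \<omega>))\<^sup>2))"
    unfolding eq gauss_coords_def by (intro P.product_integrable_prod fin int1)
  have val: "(\<integral>\<omega>. exp (- 3 / 2 * (norm (vec_of B \<omega>))\<^sup>2) \<partial>gauss_coords B) = (1/2) ^ (n + 1)"
    unfolding eq gauss_coords_def
    by (subst P.product_integral_prod[OF fin int1]) (simp_all only: val1 prod_constant B(2))
  have "measure (gauss_coords B) {\<omega> \<in> space (gauss_coords B). norm (vec_of B \<omega>) \<le> sqrt (real n) / 2}
      \<le> measure (gauss_coords B) {\<omega> \<in> space (gauss_coords B). exp (- 3 / 2 * (norm (vec_of B \<omega>))\<^sup>2) \<ge> exp (- 3 * real n / 8)}"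
  proof (rule finite_measure_mono)
    have "(norm (vec_of B \<omega>))\<^sup>2 \<le> real n / 4" if "norm (vec_of B \<omega>) \<le> sqrt (real n) / 2" for \<omega>
      using power_mono[OF that, of 2] by (simp add: power_divide)
    then show "{\<omega> \<in> space (gauss_coords B). norm (vec_of B \<omega>) \<le> sqrt (real n) / 2}
      \<subseteq> {\<omega> \<in> space (gauss_coords B). exp (- 3 / 2 * (norm (vec_of B \<omega>))\<^sup>2) \<ge> exp (- 3 * real n / 8)}"
      by (auto simp: field_simps)
  qed measurable
  also have "\<dots> \<le> (\<integral>\<omega>. exp (- 3 / 2 * (norm (vec_of B \<omega>))\<^sup>2) \<partial>gauss_coords B) / exp (- 3 * real n / 8)"
    by (rule integral_Markov_inequality_measure[where A="{}", OF int]) auto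
  also have "\<dots> = (1/2) ^ (n + 1) * exp (3 * real n / 8)"
    unfolding val by (simp add: exp_minus field_simps)
  also have "\<dots> \<le> exp (- real n / 8)"
  proof -
    have "exp (real n / 2) \<le> 2 ^ n"
    proof -
      have "exp (1::real) \<le> 2^2" using e_less_272 by simp
      then have "exp (1/2::real) ^ 2 \<le> 2 ^ 2" by (simp add: exp_double[symmetric])
      then have "exp (1/2::real) \<le> 2" by (rule power2_le_imp_le) simp
      then have "exp (1/2::real) ^ n \<le> 2 ^ n" by (intro power_mono) auto
      then show ?thesis by (simp add: exp_of_nat_mult[symmetric])
    qed
    also have "(2::real) ^ n \<le> 2 ^ (n + 1)" by simp
    finally have small: "exp (real n / 2) * (1/2)^(n+1) \<le> 1" by (simp add: power_divide)
    have split: "exp (- real n / 8) * exp (real n / 2) = exp (3 * real n / 8)"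
      by (simp add: mult_exp_exp)
    have "(1/2)^(n+1) * exp (3 * real n / 8) = exp (- real n / 8) * (exp (real n / 2) * (1/2)^(n+1))"
      unfolding mult.assoc[symmetric] split by (rule mult.commute)
    also have "\<dots> \<le> exp (- real n / 8) * 1"
      using small by (rule mult_left_mono) simp
    finally show ?thesis by simp
  qed
  finally show ?thesis .
qed

section \<open>Rotation invariance of the Gaussian direction\<close>

definition reflection :: "'a::real_inner \<Rightarrow> 'a \<Rightarrow> 'a" where
  "reflection v x = x - (2 * (x \<bullet> v) / (v \<bullet> v)) *\<^sub>R v"

lemma orthogonal_transformation_reflection: "orthogonal_transformation (reflection v)"
  unfolding orthogonal_transformation_def
proof (intro conjI allI)
  show "linear (reflection v)"
    by (rule linearI) (simp_all add: reflection_def algebra_simps add_divide_distrib)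
  show "reflection v x \<bullet> reflection v y = x \<bullet> y" for x y
    by (cases "v = 0")
      (simp_all add: reflection_def inner_diff_left inner_diff_right inner_commute field_simps)
qed

lemma reflection_involution: "reflection v (reflection v x) = x"
  by (cases "v = 0") (simp_all add: reflection_def inner_diff_left field_simps)

text \<open>
This is why the reflections act transitively on every sphere around the origin.
\<close>

lemma reflection_swap:
  assumes "norm x = norm y"
  shows "reflection (x - y) x = y"
proof (cases "x = y")
  case False
  have xy: "x \<bullet> x = y \<bullet> y" using assms by (simp add: norm_eq)
  then have "2 * (x \<bullet> (x - y)) = (x - y) \<bullet> (x - y)"
    by (simp add: inner_diff_left inner_diff_right inner_commute)
  then show ?thesis using False by (simp add: reflection_def)
qed (simp add: reflection_def)

lemma reflection_mem:
  assumes "subspace F" "v \<in> F" "x \<in> F"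
  shows "reflection v x \<in> F"
  using assms by (simp add: reflection_def subspace_diff subspace_scale)

lemma reflection_measurable[measurable]: "reflection (v::'a::euclidean_space) \<in> borel \<rightarrow>\<^sub>M borel"
  by (intro borel_measurable_continuous_onI linear_continuous_on
      linear_conv_bounded_linear[THEN iffD1] orthogonal_transformation_linear orthogonal_transformation_reflection)

lemma distr_lborel_orthogonal:
  fixes U :: "real^'m::{finite,wellorder} \<Rightarrow> real^'m::_"
  assumes U: "orthogonal_transformation U"
  shows "distr lborel borel U = lborel"
proof (rule lborel_eqI[symmetric])
  have lin: "linear U" "bij U"
    using U by (auto simp: orthogonal_transformation_linear orthogonal_transformation_bij)
  have cont: "continuous_on UNIV U"
    using lin(1) by (simp add: linear_continuous_on linear_conv_bounded_linear)
  then have [measurable]: "U \<in> borel \<rightarrow>\<^sub>M borel"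
    by (rule borel_measurable_continuous_onI)
  fix l u :: "real^'m::_" assume lu: "\<And>b. b \<in> Basis \<Longrightarrow> l \<bullet> b \<le> u \<bullet> b"
  have eq: "U -` box l u = inv U ` box l u"
    using lin(2) by (simp add: bij_vimage_eq_inv_image)
  have bor: "inv U ` box l u \<in> sets borel"
    unfolding eq[symmetric] using open_vimage[OF open_box cont] by simp
  have lm: "inv U ` box l u \<in> lmeasurable"
    by (rule measurable_orthogonal_image[OF orthogonal_transformation_inv[OF U]]) simp
  have "emeasure (distr lborel borel U) (box l u) = emeasure lborel (inv U ` box l u)"
    by (subst emeasure_distr) (auto simp: eq)
  also have "\<dots> = emeasure lebesgue (inv U ` box l u)"
    using bor by simp
  also have "\<dots> = ennreal (measure lebesgue (inv U ` box l u))"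
    using lm by (intro emeasure_eq_measure2)
  also have "measure lebesgue (inv U ` box l u) = measure lebesgue (box l u)"
    by (rule measure_orthogonal_image[OF orthogonal_transformation_inv[OF U]]) simp
  also have "measure lebesgue (box l u) = measure lborel (box l u)" by simp
  finally show "emeasure (distr lborel borel U) (box l u) = ennreal (\<Prod>b\<in>Basis. (u - l) \<bullet> b)"
    using lu by (simp add: measure_lborel_box_eq)
qed simp

lemma gauss_coords_Basis:
  "distr (gauss_coords Basis) borel (vec_of Basis)
     = density lborel (\<lambda>x::'a::euclidean_space. ennreal (\<Prod>b\<in>Basis. std_normal_density (x \<bullet> b)))"
proof -
  let ?L = "\<Pi>\<^sub>M b\<in>(Basis::'a set). (lborel :: real measure)"
  interpret L: product_sigma_finite "\<lambda>_::'a. lborel :: real measure" ..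
  interpret P: product_prob_space "\<lambda>_::'a. std_normal" by (rule product_prob_space_std_normal)
  have dens: "density ?L (\<lambda>\<omega>. ennreal (\<Prod>b\<in>Basis. std_normal_density (\<omega> b))) = gauss_coords (Basis::'a set)"
    unfolding gauss_coords_def
  proof (rule P.PiM_eqI)
    fix A :: "'a \<Rightarrow> real set" assume "\<And>b. b \<in> Basis \<Longrightarrow> A b \<in> sets std_normal"
    then have A[measurable]: "\<And>b. b \<in> Basis \<Longrightarrow> A b \<in> sets borel" by simp
    have "emeasure (density ?L (\<lambda>\<omega>. ennreal (\<Prod>b\<in>Basis. std_normal_density (\<omega> b)))) (Pi\<^sub>E Basis A)
        = (\<integral>\<^sup>+\<omega>. ennreal (\<Prod>b\<in>Basis. std_normal_density (\<omega> b)) * indicator (Pi\<^sub>E Basis A) \<omega> \<partial>?L)"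
      by (rule emeasure_density) (auto intro!: sets_PiM_I_finite)
    also have "\<dots> = (\<integral>\<^sup>+\<omega>. (\<Prod>b\<in>Basis. ennreal (std_normal_density (\<omega> b)) * indicator (A b) (\<omega> b)) \<partial>?L)"
      by (intro nn_integral_cong)
        (auto simp: prod.distrib prod_ennreal space_PiM PiE_iff indicator_def prod_zero_iff)
    also have "\<dots> = (\<Prod>b\<in>Basis. emeasure std_normal (A b))"
      by (subst L.product_nn_integral_prod) (auto simp: emeasure_density intro!: prod.cong)
    finally show "emeasure (density ?L (\<lambda>\<omega>. ennreal (\<Prod>b\<in>Basis. std_normal_density (\<omega> b)))) (Pi\<^sub>E Basis A)
      = (\<Prod>b\<in>Basis. emeasure std_normal (A b))" .
  qed (auto cong: sets_PiM_cong)
  have coord: "vec_of Basis \<omega> \<bullet> b = \<omega> b" if "b \<in> Basis" for \<omega> and b :: 'a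
    using that by (simp add: vec_of_def inner_sum_left inner_Basis if_distrib cong: if_cong)
  have lb: "(lborel :: 'a measure) = distr ?L borel (vec_of Basis)"
    unfolding lborel_def[where 'a='a] lborel_eq_real[symmetric] vec_of_def[abs_def] ..
  have m: "vec_of Basis \<in> ?L \<rightarrow>\<^sub>M (borel :: 'a measure)"
    unfolding vec_of_def[abs_def] by measurable
  have "density lborel (\<lambda>x::'a. ennreal (\<Prod>b\<in>Basis. std_normal_density (x \<bullet> b)))
      = distr (density ?L (\<lambda>\<omega>. ennreal (\<Prod>b\<in>Basis. std_normal_density (vec_of Basis \<omega> \<bullet> b)))) borel (vec_of Basis)"
    unfolding lb by (rule density_distr) (use m in measurable)
  also have "\<dots> = distr (gauss_coords Basis) borel (vec_of Basis)"
    unfolding dens[symmetric] by (simp add: coord)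
  finally show ?thesis ..
qed

text \<open>
The density of the full Gaussian depends on the norm only.
\<close>

lemma gauss_full_orthogonal:
  fixes U :: "real^'m::{finite,wellorder} \<Rightarrow> real^'m::_"
  assumes U: "orthogonal_transformation U"
  shows "distr (distr (gauss_coords Basis) borel (vec_of Basis)) borel U
       = distr (gauss_coords Basis) borel (vec_of Basis)"
proof -
  let ?\<rho> = "\<lambda>x::real^'m::_. ennreal (\<Prod>b\<in>Basis. std_normal_density (x \<bullet> b))"
  have [measurable]: "U \<in> borel \<rightarrow>\<^sub>M borel"
    using orthogonal_transformation_linear[OF U]
    by (intro borel_measurable_continuous_onI) (simp add: linear_continuous_on linear_conv_bounded_linear)
  have radial: "?\<rho> x = ennreal ((1 / sqrt (2 * pi)) ^ card (Basis :: (real^'m::_) set) * exp (- (norm x)\<^sup>2 / 2))" for x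
    unfolding std_normal_density_def prod.distrib power2_norm_eq_inner euclidean_inner[of x x]
    by (simp add: exp_sum[symmetric] sum_negf sum_divide_distrib power2_eq_square)
  have inv: "?\<rho> (U x) = ?\<rho> x" for x
    unfolding radial orthogonal_transformation_norm[OF U] ..
  have "density lborel ?\<rho> = density (distr lborel borel U) ?\<rho>"
    by (simp add: distr_lborel_orthogonal[OF U])
  also have "\<dots> = distr (density lborel (\<lambda>x. ?\<rho> (U x))) borel U"
    by (rule density_distr) measurable
  finally show ?thesis unfolding gauss_coords_Basis inv ..
qed

text \<open>
The Gaussian vector of an orthonormal system \<open>B\<close> is the image of a full Gaussian vector under the linear map
\<open>W\<close> that reads off \<open>card B\<close> of the coordinates.  The reflection along \<open>v\<close> lifts through \<open>W\<close> to the reflection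
along \<open>u\<close>, where \<open>u\<close> has the same coordinates as \<open>v\<close>, and the full Gaussian is invariant under the latter.
The index type \<open>bit0\<close> of the full space is well-ordered and large enough for \<open>B\<close>.
\<close>

lemma gauss_reflection:
  fixes B :: "(real^'n) set"
  assumes B: "orthonormal B" and v: "v \<in> span B"
  shows "distr (distr (gauss_coords B) borel (vec_of B)) borel (reflection v)
       = distr (gauss_coords B) borel (vec_of B)"
proof -
  let ?\<gamma> = "distr (gauss_coords Basis) borel (vec_of Basis) :: (real^('n bit0)) measure"
  have fin: "finite B" using B by (simp add: orthonormal_def)
  have "independent B"
    using B by (intro pairwise_orthogonal_independent) (auto simp: orthonormal_def)
  then have "card B \<le> DIM(real^'n)"
    using independent_bound_general[of B] dim_subset_UNIV[of B] by linarith
  then have "card B \<le> card (Basis :: (real^('n bit0)) set)"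
    by (simp add: card_bit0)
  then obtain f :: "real^'n \<Rightarrow> real^('n bit0)" where f: "f ` B \<subseteq> Basis" "inj_on f B"
    using card_le_inj[OF fin finite_Basis] by blast
  have BB: "b \<bullet> c = (if b = c then 1 else 0)" if "b \<in> B" "c \<in> B" for b c
    using B that by (auto simp: orthonormal_def pairwise_def orthogonal_def norm_eq_1)
  have fBB: "f b \<bullet> f c = (if b = c then 1 else 0)" if "b \<in> B" "c \<in> B" for b c
    using f that by (auto simp: inner_Basis inj_on_def image_subset_iff)
  define W where "W x = (\<Sum>b\<in>B. (x \<bullet> f b) *\<^sub>R b)" for x
  have W[measurable]: "W \<in> borel \<rightarrow>\<^sub>M borel"
    unfolding W_def[abs_def] by measurable
  have law: "distr ?\<gamma> borel W = distr (gauss_coords B) borel (vec_of B)"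
  proof -
    have re: "distr (gauss_coords Basis) (gauss_coords B) (\<lambda>\<omega>. \<lambda>b\<in>B. \<omega> (f b)) = gauss_coords B"
      unfolding gauss_coords_def
      using distr_PiM_reindex[of Basis "\<lambda>_. std_normal" f B] f prob_space_std_normal
      by (auto simp: image_subset_iff_funcset)
    have m: "(\<lambda>\<omega>. \<lambda>b\<in>B. \<omega> (f b)) \<in> gauss_coords Basis \<rightarrow>\<^sub>M gauss_coords B"
      unfolding gauss_coords_def using f
      by (intro measurable_restrict measurable_component_singleton) auto
    have "W (vec_of Basis \<omega>) = vec_of B (\<lambda>b\<in>B. \<omega> (f b))" for \<omega>
    proof -
      have "vec_of Basis \<omega> \<bullet> f b = \<omega> (f b)" if "b \<in> B" for b
        using that f by (auto simp: vec_of_def inner_sum_left inner_Basis if_distrib image_subset_iff cong: if_cong)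
      then show ?thesis by (simp add: W_def vec_of_def)
    qed
    then have "distr ?\<gamma> borel W = distr (gauss_coords Basis) borel (vec_of B \<circ> (\<lambda>\<omega>. \<lambda>b\<in>B. \<omega> (f b)))"
      by (subst distr_distr) (auto simp: comp_def)
    also have "\<dots> = distr (distr (gauss_coords Basis) (gauss_coords B) (\<lambda>\<omega>. \<lambda>b\<in>B. \<omega> (f b))) borel (vec_of B)"
      by (subst distr_distr[OF _ m]) auto
    finally show ?thesis unfolding re .
  qed
  define u where "u = (\<Sum>b\<in>B. (v \<bullet> b) *\<^sub>R f b)"
  have vexp: "(\<Sum>b\<in>B. (v \<bullet> b) *\<^sub>R b) = v"
  proof -
    obtain c where c: "v = (\<Sum>b\<in>B. c b *\<^sub>R b)"
      using v by (auto simp: span_finite[OF fin])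
    have "v \<bullet> b = c b" if "b \<in> B" for b
      using that fin by (simp add: c inner_sum_left BB if_distrib cong: if_cong)
    then show ?thesis by (simp add: c)
  qed
  have uf: "u \<bullet> f b = v \<bullet> b" if "b \<in> B" for b
    using that fin by (simp add: u_def inner_sum_left fBB if_distrib cong: if_cong)
  have Wu: "W u = v" unfolding W_def using uf vexp by simp
  have xu: "x \<bullet> u = W x \<bullet> v" for x
    by (simp add: u_def W_def inner_sum_left inner_sum_right inner_commute mult.commute)
  have uu: "u \<bullet> u = v \<bullet> v" unfolding xu Wu ..
  have commute: "reflection v (W x) = W (reflection u x)" for x
  proof -
    have "W (x - c *\<^sub>R u) = W x - c *\<^sub>R W u" for c
      by (simp add: W_def inner_diff_left scaleR_left_diff_distrib sum_subtractf scaleR_sum_right)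
    then show ?thesis unfolding reflection_def xu uu Wu by simp
  qed
  have "distr (distr ?\<gamma> borel W) borel (reflection v) = distr (distr ?\<gamma> borel (reflection u)) borel W"
    by (subst (1 2) distr_distr) (auto simp: comp_def commute)
  also have "distr ?\<gamma> borel (reflection u) = ?\<gamma>"
    by (rule gauss_full_orthogonal[OF orthogonal_transformation_reflection])
  finally show ?thesis unfolding law .
qed

definition gauss_direction :: "'a::euclidean_space set \<Rightarrow> 'a measure" where
  "gauss_direction B = distr (gauss_coords B) borel (\<lambda>\<omega>. sgn (vec_of B \<omega>))"

lemma prob_space_gauss_direction: "prob_space (gauss_direction B)"
proof -
  interpret prob_space "gauss_coords B" by (rule prob_space_gauss_coords)
  show ?thesis unfolding gauss_direction_def by (rule prob_space_distr) measurable
qed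

lemma gauss_vec_nonzero:
  fixes B :: "'a::euclidean_space set"
  assumes B: "orthonormal B" "B \<noteq> {}"
  shows "AE \<omega> in gauss_coords B. vec_of B \<omega> \<noteq> 0"
proof -
  obtain b where b: "b \<in> B" using B(2) by blast
  interpret P: product_prob_space "\<lambda>_::'a. std_normal" B by (rule product_prob_space_std_normal)
  have "AE x in std_normal. x \<noteq> 0"
    using AE_lborel_singleton[of "0::real"] by (subst AE_density) auto
  then have "AE \<omega> in gauss_coords B. \<omega> b \<noteq> 0"
    unfolding gauss_coords_def by (rule P.AE_component[OF b])
  then show ?thesis
  proof eventually_elim
    case (elim \<omega>)
    then have "0 < (\<Sum>b\<in>B. (\<omega> b)\<^sup>2)"
      using b B(1) by (intro sum_pos2[of _ b]) (auto simp: orthonormal_def)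
    then show ?case unfolding norm_vec_of[OF B(1), symmetric] by auto
  qed
qed

lemma gauss_direction_sphere:
  fixes B :: "'a::euclidean_space set"
  assumes B: "orthonormal B" "B \<noteq> {}"
  shows "AE y in gauss_direction B. y \<in> span B \<inter> sphere 0 1"
proof -
  have cl: "closed (span B)" by (rule closed_span)
  have "AE \<omega> in gauss_coords B. sgn (vec_of B \<omega>) \<in> span B \<inter> sphere 0 1"
    using gauss_vec_nonzero[OF B]
    by eventually_elim (auto simp: norm_sgn sgn_div_norm intro!: span_scale vec_of_in_span)
  then show ?thesis
    unfolding gauss_direction_def using cl by (subst AE_distr_iff) auto
qed

lemma gauss_direction_reflection:
  fixes B :: "(real^'n) set"
  assumes B: "orthonormal B" and v: "v \<in> span B"
  shows "distr (gauss_direction B) borel (reflection v) = gauss_direction B"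
proof -
  have sgn: "reflection v (sgn x) = sgn (reflection v x)" for x
    using orthogonal_transformation_scaleR[OF orthogonal_transformation_reflection[of v]]
      orthogonal_transformation_norm[OF orthogonal_transformation_reflection[of v]]
    by (simp add: sgn_div_norm)
  let ?\<gamma> = "distr (gauss_coords B) borel (vec_of B)"
  have dir: "gauss_direction B = distr ?\<gamma> borel sgn"
    unfolding gauss_direction_def by (subst distr_distr) (auto simp: comp_def)
  have "distr (distr ?\<gamma> borel sgn) borel (reflection v) = distr (distr ?\<gamma> borel (reflection v)) borel sgn"
    by (subst (1 2) distr_distr) (auto simp: comp_def sgn)
  then show ?thesis unfolding dir gauss_reflection[OF B v] .
qed

section \<open>Random subspaces\<close>

lemma closest_point_subspace:
  fixes E :: "'a::euclidean_space set"
  assumes E: "subspace E"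
  shows "closest_point E x \<in> E" "y \<in> E \<Longrightarrow> (x - closest_point E x) \<bullet> y = 0"
proof -
  have ne: "closed E" "E \<noteq> {}" "convex E"
    using closed_subspace[OF E] subspace_0[OF E] subspace_imp_convex[OF E] by auto
  show c: "closest_point E x \<in> E" by (rule closest_point_in_set) (use ne in auto)
  have le: "(x - closest_point E x) \<bullet> y \<le> 0" if "y \<in> E" for y
    using closest_point_dot[OF ne(3,1), of "closest_point E x + y" x] c that E
    by (simp add: subspace_add)
  show "(x - closest_point E x) \<bullet> y = 0" if "y \<in> E"
    using le[OF that] le[of "- y"] that E by (simp add: subspace_neg)
qed

lemma closest_point_subspace_unique:
  fixes E :: "'a::euclidean_space set"
  assumes E: "subspace E" and p: "p \<in> E" "\<And>y. y \<in> E \<Longrightarrow> (x - p) \<bullet> y = 0"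
  shows "closest_point E x = p"
proof -
  let ?d = "p - closest_point E x"
  have "?d \<in> E" using closest_point_subspace(1)[OF E] p(1) E by (simp add: subspace_diff)
  then have "((x - closest_point E x) - (x - p)) \<bullet> ?d = 0"
    unfolding inner_diff_left[of "x - closest_point E x" "x - p"]
    using closest_point_subspace(2)[OF E, of ?d x] p(2)[of ?d] by simp
  then show ?thesis by simp
qed

lemma linear_closest_point:
  fixes E :: "'a::euclidean_space set"
  assumes E: "subspace E"
  shows "linear (closest_point E)"
proof (rule linearI)
  note cp = closest_point_subspace[OF E]
  show "closest_point E (x + y) = closest_point E x + closest_point E y" for x y
  proof (rule closest_point_subspace_unique[OF E])
    show "closest_point E x + closest_point E y \<in> E" using cp(1) E by (simp add: subspace_add)
    show "(x + y - (closest_point E x + closest_point E y)) \<bullet> z = 0" if "z \<in> E" for z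
      using cp(2)[OF that, of x] cp(2)[OF that, of y] by (simp add: inner_diff_left inner_add_left)
  qed
  show "closest_point E (c *\<^sub>R x) = c *\<^sub>R closest_point E x" for c x
  proof (rule closest_point_subspace_unique[OF E])
    show "c *\<^sub>R closest_point E x \<in> E" using cp(1) E by (simp add: subspace_scale)
    show "(c *\<^sub>R x - c *\<^sub>R closest_point E x) \<bullet> z = 0" if "z \<in> E" for z
      using cp(2)[OF that, of x] by (simp add: inner_diff_left)
  qed
qed

lemma closest_point_orthogonal_image:
  fixes E :: "'a::euclidean_space set"
    and U :: "'a \<Rightarrow> 'a"
  assumes E: "subspace E" and U: "orthogonal_transformation U"
  shows "closest_point (U ` E) x = U (closest_point E (inv U x))"
proof (rule closest_point_subspace_unique)
  have lin: "linear U" using U by (rule orthogonal_transformation_linear)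
  show "subspace (U ` E)" using lin E by (rule linear_subspace_image)
  show "U (closest_point E (inv U x)) \<in> U ` E" using closest_point_subspace(1)[OF E] by blast
  fix y assume "y \<in> U ` E"
  then obtain z where z: "y = U z" "z \<in> E" by blast
  have "x = U (inv U x)" using orthogonal_transformation_surj[OF U] by (simp add: surj_f_inv_f)
  then have "x - U (closest_point E (inv U x)) = U (inv U x - closest_point E (inv U x))"
    by (metis lin linear_diff)
  then show "(x - U (closest_point E (inv U x))) \<bullet> y = 0"
    using closest_point_subspace(2)[OF E z(2)] U z(1) by (simp add: orthogonal_transformation_def)
qed

abbreviation projection_matrix :: "(real^'n) set \<Rightarrow> real^'n^'n" where
  "projection_matrix E \<equiv> matrix (closest_point E)"

lemma space_grassmannian: "space (grassmannian k) = {E. subspace E \<and> dim E = k}"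
  by (simp add: grassmannian_def)

lemma measurable_projection_matrix: "projection_matrix \<in> grassmannian k \<rightarrow>\<^sub>M borel"
  unfolding grassmannian_def by (rule measurable_vimage_algebra1) simp

text \<open>
Membership in a subspace is a closed condition on its projection matrix.  All measurability statements about
random subspaces rest on this.
\<close>

lemma projection_matrix_fixes_iff:
  assumes "subspace E"
  shows "projection_matrix E *v x = x \<longleftrightarrow> x \<in> E"
proof -
  have "projection_matrix E *v x = closest_point E x"
    using matrix_vector_mul(2)[OF linear_closest_point[OF assms]] by (rule fun_cong)
  moreover have "closed E" "E \<noteq> {}"
    using closed_subspace[OF assms] subspace_0[OF assms] by auto
  ultimately show ?thesis by (simp add: closest_point_refl)
qed

lemma measurable_orthogonal_image_grassmannian:
  fixes U :: "real^'n \<Rightarrow> real^'n"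
  assumes U: "orthogonal_transformation U"
  shows "(\<lambda>E. U ` E) \<in> grassmannian k \<rightarrow>\<^sub>M grassmannian k"
proof -
  have lin: "linear U" "inj U" "linear (inv U)"
    using U orthogonal_transformation_inv[OF U]
    by (auto simp: orthogonal_transformation_linear orthogonal_transformation_inj)
  have "projection_matrix (U ` E) = matrix U ** (projection_matrix E ** matrix (inv U))" if "E \<in> space (grassmannian k)" for E
  proof -
    have E: "subspace E" using that by (simp add: space_grassmannian)
    have "closest_point (U ` E) = U \<circ> (closest_point E \<circ> inv U)"
      using closest_point_orthogonal_image[OF E U] by auto
    then show ?thesis
      using lin linear_closest_point[OF E] by (simp add: matrix_compose linear_compose)
  qed
  moreover have "(\<lambda>E. matrix U ** (projection_matrix E ** matrix (inv U))) \<in> grassmannian k \<rightarrow>\<^sub>M borel"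
  proof (rule measurable_compose[OF measurable_projection_matrix])
    show "(\<lambda>A. matrix U ** (A ** matrix (inv U))) \<in> borel \<rightarrow>\<^sub>M borel"
      unfolding matrix_matrix_mult_def
      by (intro borel_measurable_continuous_onI continuous_intros)
  qed
  ultimately have m: "(\<lambda>E. projection_matrix (U ` E)) \<in> grassmannian k \<rightarrow>\<^sub>M borel"
    by (subst measurable_cong)
  have "U ` E \<in> {E. subspace E \<and> dim E = k}" if "E \<in> space (grassmannian k)" for E
    using that lin linear_subspace_image[OF lin(1)] dim_image_eq[OF lin(1), of E]
    by (auto simp: space_grassmannian intro: inj_on_subset)
  with m show ?thesis
    unfolding grassmannian_def by (intro measurable_vimage_algebra2) (auto simp: grassmannian_def)
qed

lemma closed_fixed_pairs: "closed {p :: (real^'n) \<times> (real^'n^'n). snd p *v fst p = fst p}"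
  unfolding matrix_vector_mult_def
  by (intro closed_Collect_eq continuous_intros)

lemma sets_grassmannian_meets:
  fixes C :: "(real^'n) set"
  assumes "compact C"
  shows "{E \<in> space (grassmannian k). E \<inter> C \<noteq> {}} \<in> sets (grassmannian k)"
proof -
  let ?P = "{A. \<exists>x. x \<in> C \<and> (x, A) \<in> {p. snd p *v fst p = fst p}}"
  have "closed ?P"
    by (rule closed_compact_projection[OF assms closed_fixed_pairs])
  then have "projection_matrix -` ?P \<inter> space (grassmannian k) \<in> sets (grassmannian k)"
    by (intro measurable_sets[OF measurable_projection_matrix]) simp
  also have "projection_matrix -` ?P \<inter> space (grassmannian k) = {E \<in> space (grassmannian k). E \<inter> C \<noteq> {}}"
    by (auto simp: space_grassmannian projection_matrix_fixes_iff)
  finally show ?thesis .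
qed

lemma sets_pair_grassmannian_near:
  fixes C :: "(real^'n) set"
  assumes "compact C"
  shows "{p \<in> space (grassmannian k \<Otimes>\<^sub>M borel). \<exists>x \<in> fst p \<inter> C. dist x (snd p) \<le> e} \<in> sets (grassmannian k \<Otimes>\<^sub>M borel)"
proof -
  define T :: "((real^'n) \<times> ((real^'n^'n) \<times> (real^'n))) set"
    where "T = {q. fst (snd q) *v fst q = fst q} \<inter> {q. dist (fst q) (snd (snd q)) \<le> e}"
  have "closed T"
    unfolding T_def matrix_vector_mult_def
    by (intro closed_Int closed_Collect_eq closed_Collect_le continuous_intros)
  then have cl: "closed {r. \<exists>x. x \<in> C \<and> (x, r) \<in> T}"
    by (rule closed_compact_projection[OF assms])
  have m: "(\<lambda>p. (projection_matrix (fst p), snd p :: real^'n)) \<in> grassmannian k \<Otimes>\<^sub>M borel \<rightarrow>\<^sub>M borel"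
    by (intro borel_measurable_Pair measurable_compose[OF measurable_fst measurable_projection_matrix] measurable_snd)
  have "(\<lambda>p. (projection_matrix (fst p), snd p :: real^'n)) -` {r. \<exists>x. x \<in> C \<and> (x, r) \<in> T} \<inter> space (grassmannian k \<Otimes>\<^sub>M borel) \<in> sets (grassmannian k \<Otimes>\<^sub>M borel)"
    by (rule measurable_sets[OF m]) (use cl in simp)
  also have "(\<lambda>p. (projection_matrix (fst p), snd p :: real^'n)) -` {r. \<exists>x. x \<in> C \<and> (x, r) \<in> T} \<inter> space (grassmannian k \<Otimes>\<^sub>M borel)
     = {p \<in> space (grassmannian k \<Otimes>\<^sub>M borel). \<exists>x \<in> fst p \<inter> C. dist x (snd p) \<le> e}"
    by (auto simp: T_def space_pair_measure space_grassmannian projection_matrix_fixes_iff)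
  finally show ?thesis .
qed

lemma subspaces_meet_sphere:
  fixes E F :: "'a::euclidean_space set"
  assumes E: "subspace E" and F: "subspace F" and dim: "DIM('a) < dim E + dim F"
  shows "E \<inter> (F \<inter> sphere 0 1) \<noteq> {}"
proof -
  have "dim {x + y |x y. x \<in> E \<and> y \<in> F} \<le> DIM('a)" by (rule dim_subset_UNIV)
  then have "0 < dim (E \<inter> F)" using dim_sums_Int[OF E F] dim by linarith
  then have "\<not> E \<inter> F \<subseteq> {0}" by (metis dim_eq_0 less_irrefl)
  then obtain x where x: "x \<in> E" "x \<in> F" "x \<noteq> 0" by blast
  then have "sgn x \<in> E \<inter> (F \<inter> sphere 0 1)"
    using E F by (simp add: sgn_div_norm subspace_scale)
  then show ?thesis by blast
qed

lemma dist_reflection: "dist (reflection v x) (reflection v y) = dist x y"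
proof -
  have "reflection v x - reflection v y = reflection v (x - y)"
    by (rule linear_diff[OF orthogonal_transformation_linear[OF orthogonal_transformation_reflection], symmetric])
  then show ?thesis
    by (simp add: dist_norm orthogonal_transformation_norm[OF orthogonal_transformation_reflection])
qed

lemma compact_sphere_Int_subspace: "subspace F \<Longrightarrow> compact (F \<inter> sphere 0 (1::real))" for F :: "'a::euclidean_space set"
  by (intro closed_Int_compact closed_subspace compact_sphere)

text \<open>
A random direction in \<open>F\<close> whose law is invariant under the reflections along vectors of \<open>F\<close>.
The direction of a Gaussian vector in \<open>F\<close> is the instance of interest.
\<close>

locale invariant_direction = prob_space \<sigma> for \<sigma> :: "(real^'n) measure" +
  fixes F :: "(real^'n) set"
  assumes F: "subspace F"
    and sets_dir[measurable_cong]: "sets \<sigma> = sets borel"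
    and on_sphere: "AE y in \<sigma>. y \<in> F \<inter> sphere 0 1"
    and invariant: "v \<in> F \<Longrightarrow> distr \<sigma> borel (reflection v) = \<sigma>"
begin

definition S :: "(real^'n) set" where "S = F \<inter> sphere 0 1"

lemma compact_S: "compact S"
  unfolding S_def by (rule compact_sphere_Int_subspace[OF F])

lemma on_S: "AE y in \<sigma>. y \<in> S"
  using on_sphere by (simp add: S_def)

lemma compact_near:
  assumes "compact D"
  shows "compact {x \<in> S. \<exists>y\<in>D. dist x y \<le> e}"
proof -
  have "closed {x. \<exists>y. y \<in> D \<and> (y, x) \<in> {q. dist (snd q) (fst q) \<le> e}}"
    by (rule closed_compact_projection[OF assms]) (intro closed_Collect_le continuous_intros)
  then have "compact (S \<inter> {x. \<exists>y. y \<in> D \<and> (y, x) \<in> {q. dist (snd q) (fst q) \<le> e}})"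
    by (rule compact_Int_closed[OF compact_S])
  also have "S \<inter> {x. \<exists>y. y \<in> D \<and> (y, x) \<in> {q. dist (snd q) (fst q) \<le> e}} = {x \<in> S. \<exists>y\<in>D. dist x y \<le> e}"
    by auto
  finally show ?thesis .
qed

lemma reflection_S: "v \<in> F \<Longrightarrow> x \<in> S \<Longrightarrow> reflection v x \<in> S"
  using reflection_mem[OF F] orthogonal_transformation_norm[OF orthogonal_transformation_reflection[of v]]
  by (auto simp: S_def)

lemma transitive:
  assumes "x \<in> S" "y \<in> S" obtains v where "v \<in> F" "reflection v x = y"
  using assms reflection_swap[of x y] subspace_diff[OF F, of x y] by (auto simp: S_def intro: that)

lemma nn_integral_reflection:
  assumes "v \<in> F" and [measurable]: "f \<in> borel_measurable borel"
  shows "(\<integral>\<^sup>+y. f (reflection v y) \<partial>\<sigma>) = (\<integral>\<^sup>+y. f y \<partial>\<sigma>)"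
proof -
  have "(\<integral>\<^sup>+y. f y \<partial>\<sigma>) = (\<integral>\<^sup>+y. f y \<partial>distr \<sigma> borel (reflection v))"
    by (simp add: invariant[OF assms(1)])
  also have "\<dots> = (\<integral>\<^sup>+y. f (reflection v y) \<partial>\<sigma>)"
    by (rule nn_integral_distr) measurable
  finally show ?thesis ..
qed

text \<open>
All caps of the same radius have the same mass by transitivity, and finitely many of them cover the sphere.
\<close>

lemma cap_pos:
  assumes x: "x \<in> S" and e: "0 < e"
  shows "0 < emeasure \<sigma> (cball x e)"
proof (rule ccontr)
  assume "\<not> ?thesis"
  then have zero: "emeasure \<sigma> (cball x e) = 0" by simp
  have all: "emeasure \<sigma> (cball y e) = 0" if y: "y \<in> S" for y
  proof -
    obtain v where v: "v \<in> F" "reflection v x = y" using transitive[OF x y] .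
    have "emeasure \<sigma> (cball y e) = (\<integral>\<^sup>+z. indicator (cball y e) z \<partial>\<sigma>)"
      by (simp add: sets_dir)
    also have "\<dots> = (\<integral>\<^sup>+z. indicator (cball y e) (reflection v z) \<partial>\<sigma>)"
      by (rule nn_integral_reflection[OF v(1), symmetric], rule borel_measurable_indicator) simp
    also have "\<dots> = (\<integral>\<^sup>+z. indicator (cball x e) z \<partial>\<sigma>)"
    proof (rule nn_integral_cong)
      fix z
      have "dist y (reflection v z) = dist x z"
        using dist_reflection[of v x z] by (simp only: v(2))
      then show "indicator (cball y e) (reflection v z) = (indicator (cball x e) z :: ennreal)"
        by (simp add: indicator_def)
    qed
    also have "\<dots> = 0" using zero by (simp add: sets_dir)
    finally show ?thesis .
  qed
  have "S \<subseteq> (\<Union>y\<in>S. ball y e)" using e by auto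
  then obtain Y where Y: "Y \<subseteq> S" "finite Y" "S \<subseteq> (\<Union>y\<in>Y. ball y e)"
    using compactE_image[OF compact_S, of S "\<lambda>y. ball y e"] by auto
  have "(\<Union>y\<in>Y. cball y e) \<in> null_sets \<sigma>"
    using Y(1,2) all by (intro null_sets_UN' countable_finite) (auto simp: null_sets_def sets_dir)
  then have "AE y in \<sigma>. y \<notin> (\<Union>y\<in>Y. cball y e)" by (rule AE_not_in)
  with on_S have "AE y in \<sigma>. False"
  proof eventually_elim
    case (elim y)
    then obtain z where "z \<in> Y" "y \<in> ball z e" using Y(3) by blast
    then show ?case using elim(2) by (auto intro: less_imp_le)
  qed
  then show False by simp
qed

end

text \<open>
For each subspace \<open>E\<close> let \<open>h E\<close> be the indicator of the \<open>e\<close>-neighbourhood of \<open>E \<inter> S\<close>, divided by the mass \<open>w E\<close>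
of that neighbourhood.  Thus \<open>h E\<close> is a probability density on the sphere.  As \<open>h\<close> is unchanged when a
reflection along a vector of \<open>F\<close> moves both of its arguments, its mean \<open>c y\<close> over the random subspace is
the same for all directions \<open>y\<close>, hence equal to one.  So \<open>D\<close> has the mass of
the integral of \<open>h E y\<close> over all \<open>E\<close> and all \<open>y\<close> in \<open>D\<close>; the integral over \<open>y\<close> is at most one, and it is
zero unless \<open>E\<close> contains a direction of \<open>F\<close> that is \<open>e\<close>-close to \<open>D\<close>.
\<close>

lemma (in invariant_direction) haar_meets_near:
  fixes \<mu> :: "(real^'n) set measure" and D :: "(real^'n) set"
  assumes \<mu>: "haar_grassmannian k \<mu>" and dim: "CARD('n) < k + dim F"
    and D: "compact D" "D \<subseteq> S" and e: "0 < e"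
  shows "emeasure \<sigma> D \<le> emeasure \<mu> {E \<in> space \<mu>. E \<inter> {x \<in> S. \<exists>y\<in>D. dist x y \<le> e} \<noteq> {}}"
proof -
  have sets\<mu>: "sets \<mu> = sets (grassmannian k)" and "prob_space \<mu>"
    and inv\<mu>: "\<And>U. orthogonal_transformation U \<Longrightarrow> distr \<mu> (grassmannian k) (\<lambda>E. U ` E) = \<mu>"
    using \<mu> by (auto simp: haar_grassmannian_def)
  note [measurable_cong] = sets\<mu>
  interpret \<mu>: prob_space \<mu> by fact
  interpret P: pair_prob_space \<mu> \<sigma> ..
  have sp: "space \<mu> = {E. subspace E \<and> dim E = k}"
    using sets_eq_imp_space_eq[OF sets\<mu>] by (simp add: space_grassmannian)
  have sp\<sigma>: "space \<sigma> = UNIV" using sets_eq_imp_space_eq[OF sets_dir] by simp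
  note compS = compact_S
  define N where "N = {p \<in> space (grassmannian k \<Otimes>\<^sub>M borel). \<exists>x \<in> fst p \<inter> S. dist x (snd p) \<le> e}"
  have N[measurable]: "N \<in> sets (grassmannian k \<Otimes>\<^sub>M borel)"
    unfolding N_def by (rule sets_pair_grassmannian_near[OF compS])
  have inN: "(E, y) \<in> N \<longleftrightarrow> (\<exists>x \<in> E \<inter> S. dist x y \<le> e)" if "E \<in> space \<mu>" for E y
    using that by (auto simp: N_def space_pair_measure sp space_grassmannian)
  define w where "w E = (\<integral>\<^sup>+y. indicator N (E, y) \<partial>\<sigma>)" for E
  have w[measurable]: "w \<in> borel_measurable (grassmannian k)"
    unfolding w_def by measurable
  have image: "U ` E \<in> space \<mu>" if "orthogonal_transformation U" "E \<in> space \<mu>" for U E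
    using measurable_space[OF measurable_orthogonal_image_grassmannian[OF that(1)], of E k] that(2)
    by (simp add: sp space_grassmannian)
  have N_refl: "(reflection v ` E, reflection v y) \<in> N \<longleftrightarrow> (E, y) \<in> N" if v: "v \<in> F" and E: "E \<in> space \<mu>" for v E y
  proof -
    note U = orthogonal_transformation_reflection[of v]
    note dist = dist_reflection[of v]
    have S: "reflection v x \<in> S \<longleftrightarrow> x \<in> S" for x
      using reflection_S[OF v] reflection_involution[of v] by metis
    have "(\<exists>x \<in> reflection v ` E \<inter> S. dist x (reflection v y) \<le> e) \<longleftrightarrow> (\<exists>x \<in> E \<inter> S. dist x y \<le> e)"
    proof safe
      fix x assume "x \<in> E" "reflection v x \<in> S" "dist (reflection v x) (reflection v y) \<le> e"
      then show "\<exists>x \<in> E \<inter> S. dist x y \<le> e" using S[of x] dist by auto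
    next
      fix x assume "x \<in> E" "x \<in> S" "dist x y \<le> e"
      then show "\<exists>x \<in> reflection v ` E \<inter> S. dist x (reflection v y) \<le> e"
        using S[of x] dist[of x y] by (intro bexI[of _ "reflection v x"]) auto
    qed
    then show ?thesis using inN[OF E] inN[OF image[OF U E]] by simp
  qed
  have w_refl: "w (reflection v ` E) = w E" if v: "v \<in> F" and E: "E \<in> space \<mu>" for v E
  proof -
    have E': "reflection v ` E \<in> space (grassmannian k)"
      using image[OF orthogonal_transformation_reflection E] sets_eq_imp_space_eq[OF sets\<mu>] by simp
    have "w (reflection v ` E) = (\<integral>\<^sup>+y. indicator N (reflection v ` E, reflection v y) \<partial>\<sigma>)"
      unfolding w_def
      by (rule nn_integral_reflection[OF v, symmetric])
        (rule measurable_compose[OF measurable_Pair1'[OF E'] borel_measurable_indicator[OF N]])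
    also have "\<dots> = w E"
      unfolding w_def using N_refl[OF v E] by (intro nn_integral_cong) (simp add: indicator_def)
    finally show ?thesis .
  qed
  have w_pos: "w E \<noteq> 0" "w E \<noteq> \<top>" if E: "E \<in> space \<mu>" for E
  proof -
    have "subspace E" "dim E = k" using E by (auto simp: sp)
    then obtain x where x: "x \<in> E \<inter> S"
      using subspaces_meet_sphere[OF _ F, of E] dim unfolding S_def by fastforce
    have "0 < emeasure \<sigma> (cball x e)" by (rule cap_pos[OF _ e]) (use x in blast)
    also have "\<dots> = (\<integral>\<^sup>+y. indicator (cball x e) y \<partial>\<sigma>)" by (simp add: sets_dir)
    also have "\<dots> \<le> w E"
      unfolding w_def using x inN[OF E] by (intro nn_integral_mono) (auto simp: indicator_def)
    finally show "w E \<noteq> 0" by simp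
    have "w E \<le> (\<integral>\<^sup>+y. 1 \<partial>\<sigma>)"
      unfolding w_def by (intro nn_integral_mono) (auto simp: indicator_def)
    then show "w E \<noteq> \<top>" by (auto simp: emeasure_space_1 top_unique)
  qed
  define h where "h E y = indicator N (E, y) / w E" for E y
  have h[measurable]: "(\<lambda>(E, y). h E y) \<in> borel_measurable (grassmannian k \<Otimes>\<^sub>M borel)"
    unfolding h_def by measurable
  have h_int: "(\<integral>\<^sup>+y. h E y \<partial>\<sigma>) = 1" if E: "E \<in> space \<mu>" for E
  proof -
    have E': "E \<in> space (grassmannian k)" using E sets_eq_imp_space_eq[OF sets\<mu>] by simp
    have m: "(\<lambda>y. indicator N (E, y) :: ennreal) \<in> borel_measurable \<sigma>"
      using measurable_compose[OF measurable_Pair1'[OF E'] borel_measurable_indicator[OF N]]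
      by (simp cong: measurable_cong_sets add: measurable_cong_sets[OF sets_dir refl])
    have "(\<integral>\<^sup>+y. h E y \<partial>\<sigma>) = w E / w E"
      unfolding h_def w_def by (rule nn_integral_divide[OF m])
    then show ?thesis using w_pos[OF E] by (simp add: ennreal_divide_self top.not_eq_extremum)
  qed
  define c where "c y = (\<integral>\<^sup>+E. h E y \<partial>\<mu>)" for y
  have c_refl: "c (reflection v y) = c y" if v: "v \<in> F" for v y
  proof -
    note U = orthogonal_transformation_reflection[of v]
    have hm: "(\<lambda>E. h E (reflection v y)) \<in> borel_measurable (grassmannian k)"
      using measurable_compose[OF measurable_Pair2'[of "reflection v y" borel "grassmannian k"] h] by simp
    have "c (reflection v y) = (\<integral>\<^sup>+E. h E (reflection v y) \<partial>distr \<mu> (grassmannian k) (\<lambda>E. reflection v ` E))"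
      by (simp add: c_def inv\<mu>[OF U])
    also have "\<dots> = (\<integral>\<^sup>+E. h (reflection v ` E) (reflection v y) \<partial>\<mu>)"
      using measurable_orthogonal_image_grassmannian[OF U, of k] hm
      by (intro nn_integral_distr) (simp_all cong: measurable_cong_sets add: measurable_cong_sets[OF sets\<mu> refl])
    also have "\<dots> = c y"
      unfolding c_def h_def using N_refl[OF v] w_refl[OF v]
      by (intro nn_integral_cong) (simp add: indicator_def)
    finally show ?thesis .
  qed
  have c_const: "c y = c z" if "y \<in> S" "z \<in> S" for y z
    using transitive[OF that] c_refl by metis
  have c_total: "(\<integral>\<^sup>+y. c y \<partial>\<sigma>) = 1"
  proof -
    have "(\<integral>\<^sup>+y. c y \<partial>\<sigma>) = (\<integral>\<^sup>+E. (\<integral>\<^sup>+y. h E y \<partial>\<sigma>) \<partial>\<mu>)"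
      unfolding c_def by (rule P.Fubini') measurable
    also have "\<dots> = (\<integral>\<^sup>+E. 1 \<partial>\<mu>)" by (intro nn_integral_cong h_int)
    finally show ?thesis by (simp add: \<mu>.emeasure_space_1)
  qed
  have c1: "c z = 1" if z: "z \<in> S" for z
  proof -
    have "(\<integral>\<^sup>+y. c y \<partial>\<sigma>) = (\<integral>\<^sup>+y. c z \<partial>\<sigma>)"
    proof (rule nn_integral_cong_AE)
      show "AE y in \<sigma>. c y = c z" using on_S by eventually_elim (rule c_const[OF _ z])
    qed
    then show ?thesis using c_total by (simp add: emeasure_space_1)
  qed
  have Dm[measurable]: "D \<in> sets borel" using D(1) by (simp add: compact_imp_closed)
  let ?A = "{E \<in> space \<mu>. E \<inter> {x \<in> S. \<exists>y\<in>D. dist x y \<le> e} \<noteq> {}}"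
  have A[measurable]: "?A \<in> sets (grassmannian k)"
    using sets_grassmannian_meets[OF compact_near[OF D(1)], of k] by (simp add: sp space_grassmannian)
  have "emeasure \<sigma> D = (\<integral>\<^sup>+y. indicator D y \<partial>\<sigma>)" by (simp add: sets_dir)
  also have "\<dots> = (\<integral>\<^sup>+y. indicator D y * c y \<partial>\<sigma>)"
    using c1 D(2) by (intro nn_integral_cong) (auto simp: indicator_def)
  also have "\<dots> = (\<integral>\<^sup>+y. (\<integral>\<^sup>+E. indicator D y * h E y \<partial>\<mu>) \<partial>\<sigma>)"
    unfolding c_def
    by (intro nn_integral_cong nn_integral_cmult[symmetric])
      (use measurable_compose[OF measurable_Pair2'[of _ borel "grassmannian k"] h] in
        \<open>simp cong: measurable_cong_sets add: measurable_cong_sets[OF sets\<mu> refl]\<close>)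
  also have "\<dots> = (\<integral>\<^sup>+E. (\<integral>\<^sup>+y. indicator D y * h E y \<partial>\<sigma>) \<partial>\<mu>)"
    by (rule P.Fubini') measurable
  also have "\<dots> \<le> (\<integral>\<^sup>+E. indicator ?A E \<partial>\<mu>)"
  proof (rule nn_integral_mono)
    fix E assume E: "E \<in> space \<mu>"
    show "(\<integral>\<^sup>+y. indicator D y * h E y \<partial>\<sigma>) \<le> indicator ?A E"
    proof (cases "E \<in> ?A")
      case True
      have "(\<integral>\<^sup>+y. indicator D y * h E y \<partial>\<sigma>) \<le> (\<integral>\<^sup>+y. h E y \<partial>\<sigma>)"
        by (intro nn_integral_mono) (auto simp: indicator_def)
      then show ?thesis using True h_int[OF E] by simp
    next
      case False
      have zero: "indicator D y * h E y = 0" for y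
        using False inN[OF E, of y] E by (auto simp: h_def indicator_def)
      show ?thesis unfolding zero by simp
    qed
  qed
  also have "\<dots> = emeasure \<mu> ?A"
    using A by (intro nn_integral_indicator) (simp add: sets\<mu>)
  finally show ?thesis .
qed

text \<open>
Let \<open>e\<close> tend to zero in the preceding bound: a subspace that contains directions of \<open>F\<close> arbitrarily close to the
compact set \<open>D\<close> meets \<open>D\<close>.
\<close>

lemma (in invariant_direction) haar_meets:
  fixes \<mu> :: "(real^'n) set measure" and D :: "(real^'n) set"
  assumes \<mu>: "haar_grassmannian k \<mu>" and dim: "CARD('n) < k + dim F"
    and D: "compact D" "D \<subseteq> S"
  shows "emeasure \<sigma> D \<le> emeasure \<mu> {E \<in> space \<mu>. E \<inter> D \<noteq> {}}"
proof -
  have sets\<mu>: "sets \<mu> = sets (grassmannian k)" and "prob_space \<mu>"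
    using \<mu> by (auto simp: haar_grassmannian_def)
  interpret \<mu>: prob_space \<mu> by fact
  have sp: "space \<mu> = {E. subspace E \<and> dim E = k}"
    using sets_eq_imp_space_eq[OF sets\<mu>] by (simp add: space_grassmannian)
  define e where "e m = inverse (real (Suc m))" for m
  define C where "C m = {x \<in> S. \<exists>y\<in>D. dist x y \<le> e m}" for m
  define A where "A m = {E \<in> space \<mu>. E \<inter> C m \<noteq> {}}" for m
  have "compact (C m)" for m
    unfolding C_def by (rule compact_near[OF D(1)])
  then have Am: "A m \<in> sets \<mu>" for m
    using sets_grassmannian_meets[of "C m" k] by (simp add: A_def sets\<mu> sp space_grassmannian)
  have mono: "decseq A"
  proof (rule decseq_SucI)
    fix m
    have le: "e (Suc m) \<le> e m" by (simp add: e_def)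
    have "C (Suc m) \<subseteq> C m"
    proof
      fix x assume "x \<in> C (Suc m)"
      then obtain y where "x \<in> S" "y \<in> D" "dist x y \<le> e (Suc m)" unfolding C_def by blast
      then show "x \<in> C m" unfolding C_def using le order_trans by blast
    qed
    then show "A (Suc m) \<subseteq> A m" unfolding A_def by blast
  qed
  have Inter: "(\<Inter>m. A m) = {E \<in> space \<mu>. E \<inter> D \<noteq> {}}"
  proof (rule set_eqI, rule iffI)
    fix E assume E: "E \<in> (\<Inter>m. A m)"
    then have sE: "E \<in> space \<mu>" by (auto simp: A_def)
    then have "compact (E \<inter> S)"
      by (auto simp: sp intro!: closed_Int_compact closed_subspace compact_S)
    have "E \<inter> D \<noteq> {}"
    proof
      assume "E \<inter> D = {}"
      then obtain d where d: "0 < d" "\<And>x y. x \<in> E \<inter> S \<Longrightarrow> y \<in> D \<Longrightarrow> d \<le> dist x y"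
      proof -
        have "E \<inter> S \<inter> D = {}" using \<open>E \<inter> D = {}\<close> by blast
        then have "\<exists>d>0. \<forall>x\<in>E \<inter> S. \<forall>y\<in>D. d \<le> dist x y"
          by (rule separate_compact_closed[OF \<open>compact (E \<inter> S)\<close> compact_imp_closed[OF D(1)]])
        then show ?thesis using that by blast
      qed
      obtain m where "e m < d" using reals_Archimedean[OF d(1)] by (auto simp: e_def)
      moreover have "E \<in> A m" using E by blast
      then obtain x y where "x \<in> E" "x \<in> S" "y \<in> D" "dist x y \<le> e m" unfolding A_def C_def by blast
      ultimately show False using d(2)[of x y] by auto
    qed
    then show "E \<in> {E \<in> space \<mu>. E \<inter> D \<noteq> {}}" using sE by simp
  next
    fix E assume "E \<in> {E \<in> space \<mu>. E \<inter> D \<noteq> {}}"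
    then obtain x where x: "E \<in> space \<mu>" "x \<in> E" "x \<in> D" by blast
    have "dist x x \<le> e m" for m by (simp add: e_def)
    then have "x \<in> C m" for m unfolding C_def using x D(2) by blast
    then show "E \<in> (\<Inter>m. A m)" unfolding A_def using x by blast
  qed
  have lim: "(\<lambda>m. emeasure \<mu> (A m)) \<longlonglongrightarrow> emeasure \<mu> (\<Inter>m. A m)"
    using Am mono by (intro Lim_emeasure_decseq) auto
  have "emeasure \<sigma> D \<le> emeasure \<mu> (A m)" for m
    unfolding A_def C_def by (rule haar_meets_near[OF \<mu> dim D]) (simp add: e_def)
  then show ?thesis
    unfolding Inter[symmetric] by (intro LIMSEQ_le_const[OF lim]) blast
qed

section \<open>The gauge of a section\<close>

lemma scaled_mem_iff: "0 < c \<Longrightarrow> x \<in> (\<lambda>y. c *\<^sub>R y) ` L \<longleftrightarrow> x /\<^sub>R c \<in> L" for x :: "'a::real_vector"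
  by (auto simp: image_iff intro!: bexI[of _ "x /\<^sub>R c"])

lemma convex_shrink:
  fixes L :: "'a::real_vector set"
  assumes "convex L" "0 \<in> L" "x \<in> L" "0 \<le> s" "s \<le> 1"
  shows "s *\<^sub>R x \<in> L"
  using convexD_alt[OF assms(1,2,3), of s] assms(4,5) by simp

locale body_section =
  fixes K F L :: "'a::euclidean_space set"
  assumes K: "convex_body K" and F: "subspace F" and L_def: "L = K \<inter> F"
begin

lemma convex_L: "convex L" and closed_L: "closed L" and zero_L: "0 \<in> L"
  using K F interior_subset
  by (auto simp: L_def convex_body_def convex_Int subspace_imp_convex compact_imp_closed closed_subspace
      closed_Int subspace_0)

lemma inner_ball: obtains d where "0 < d" "\<And>x. x \<in> F \<Longrightarrow> norm x \<le> d \<Longrightarrow> x \<in> L"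
proof -
  obtain d where "0 < d" "cball 0 d \<subseteq> K"
    using K mem_interior_cball[of 0 K] by (auto simp: convex_body_def)
  then show ?thesis by (intro that[of d]) (auto simp: L_def)
qed

lemma outer_ball: obtains M where "0 < M" "\<And>x. x \<in> L \<Longrightarrow> norm x \<le> M"
  using K compact_imp_bounded[of K] bounded_pos[of K] by (auto simp: convex_body_def L_def)

abbreviation R :: real where "R \<equiv> outer_radius (polar_in F L)"

lemma norm_polar_le:
  assumes q: "q \<in> polar_in F L"
  shows "norm q \<le> R"
proof -
  obtain d where d: "0 < d" "\<And>x. x \<in> F \<Longrightarrow> norm x \<le> d \<Longrightarrow> x \<in> L" by (rule inner_ball) blast
  have "norm p \<le> 1 / d" if p: "p \<in> polar_in F L" for p
  proof -
    have "sgn p \<in> F" using p F by (simp add: polar_in_def sgn_div_norm subspace_scale)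
    then have "d *\<^sub>R sgn p \<in> L"
      using F d(1) by (intro d(2)) (auto simp: norm_sgn subspace_scale)
    then have "p \<bullet> (d *\<^sub>R sgn p) \<le> 1" using p by (auto simp: polar_in_def)
    moreover have "p \<bullet> sgn p = norm p"
      by (simp add: sgn_div_norm norm_eq_sqrt_inner real_div_sqrt divide_inverse_commute[symmetric])
    ultimately show ?thesis using d(1) by (simp add: field_simps)
  qed
  then have "bdd_above (norm ` polar_in F L)" by (intro bdd_aboveI2)
  then show ?thesis unfolding outer_radius_def by (rule cSUP_upper[OF q])
qed

lemma R_pos:
  assumes "F \<noteq> {0}"
  shows "0 < R"
proof -
  obtain e where e: "e \<in> F" "e \<noteq> 0" using assms subspace_0[OF F] by blast
  obtain M where M: "0 < M" "\<And>x. x \<in> L \<Longrightarrow> norm x \<le> M" by (rule outer_ball) blast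
  define q where "q = (1 / M) *\<^sub>R sgn e"
  have "norm q = 1 / M" using M(1) e(2) by (simp add: q_def norm_sgn)
  have "q \<bullet> x \<le> 1" if "x \<in> L" for x
  proof -
    have "q \<bullet> x \<le> norm q * norm x" by (rule norm_cauchy_schwarz)
    also have "\<dots> \<le> 1" using M(1) M(2)[OF that] \<open>norm q = 1 / M\<close> by simp
    finally show ?thesis .
  qed
  then have "q \<in> polar_in F L"
    using e F by (simp add: polar_in_def q_def sgn_div_norm subspace_scale)
  then show ?thesis
    using norm_polar_le[of q] \<open>norm q = 1 / M\<close> M(1) by (simp add: less_le_trans[of 0 "1 / M"])
qed

text \<open>
The bipolar theorem in quantitative form: \<open>L\<close> contains every vector of \<open>F\<close> of norm less than \<open>1 / R\<close>.  A vector
outside of \<open>L\<close> is separated from \<open>L\<close> by a functional; its restriction to \<open>F\<close>, represented by a vector \<open>q\<close>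
of \<open>F\<close>, belongs to the polar and is larger than one at the separated vector.
\<close>

lemma mem_of_norm:
  assumes x: "x \<in> F" and c: "R * norm x < c" "0 < c"
  shows "x /\<^sub>R c \<in> L"
proof (rule ccontr)
  let ?z = "x /\<^sub>R c"
  assume "?z \<notin> L"
  then obtain a b where ab: "a \<bullet> ?z < b" "\<And>y. y \<in> L \<Longrightarrow> b < a \<bullet> y"
    using separating_hyperplane_closed_point[OF convex_L closed_L] by blast
  have b: "b < 0" using ab(2)[OF zero_L] by simp
  define q where "q = closest_point F (a /\<^sub>R b)"
  have q: "q \<bullet> y = (a \<bullet> y) / b" if "y \<in> F" for y
    using closest_point_subspace(2)[OF F that, of "a /\<^sub>R b"]
    by (simp add: q_def inner_diff_left divide_inverse mult.commute)
  have z: "?z \<in> F" using x F by (simp add: subspace_scale)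
  have "q \<bullet> y \<le> 1" if y: "y \<in> L" for y
    using q[of y] ab(2)[OF y] b y by (simp add: L_def divide_le_eq)
  then have "q \<in> polar_in F L"
    using closest_point_subspace(1)[OF F] by (simp add: polar_in_def q_def)
  then have "norm q \<le> R" by (rule norm_polar_le)
  have "1 < q \<bullet> ?z"
    unfolding q[OF z] using ab(1) b by (simp add: less_divide_eq)
  also have "q \<bullet> ?z \<le> norm q * norm ?z" by (rule norm_cauchy_schwarz)
  also have "\<dots> \<le> R * norm ?z" using \<open>norm q \<le> R\<close> by (rule mult_right_mono) simp
  also have "\<dots> < 1" using c by (simp add: field_simps)
  finally show False .
qed

lemma gauge_eq: "body_gauge L x = Inf {c. 0 < c \<and> x /\<^sub>R c \<in> L}"
  unfolding body_gauge_def by (rule arg_cong[where f=Inf]) (auto simp: scaled_mem_iff)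

lemma gauge_le: "0 < c \<Longrightarrow> x /\<^sub>R c \<in> L \<Longrightarrow> body_gauge L x \<le> c"
  unfolding gauge_eq by (rule cInf_lower) (auto intro!: bdd_belowI[of _ 0])

lemma gauge_set_nonempty:
  assumes x: "x \<in> F"
  shows "{c. 0 < c \<and> x /\<^sub>R c \<in> L} \<noteq> {}"
  using mem_of_norm[OF x, of "\<bar>R * norm x\<bar> + 1"] by (auto intro!: exI[of _ "\<bar>R * norm x\<bar> + 1"])

lemma gauge_nonneg: "x \<in> F \<Longrightarrow> 0 \<le> body_gauge L x"
  unfolding gauge_eq using gauge_set_nonempty by (intro cInf_greatest) auto

lemma gauge_less_imp_mem:
  assumes x: "x \<in> F" and c: "body_gauge L x < c"
  shows "x /\<^sub>R c \<in> L"
proof -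
  obtain s where s: "0 < s" "x /\<^sub>R s \<in> L" "s < c"
    using cInf_lessD[OF gauge_set_nonempty[OF x]] c unfolding gauge_eq by auto
  have "(s / c) *\<^sub>R (x /\<^sub>R s) \<in> L"
    by (rule convex_shrink[OF convex_L zero_L s(2)]) (use s in auto)
  then show ?thesis using s by (simp add: field_simps)
qed

lemma gauge_add:
  assumes x: "x \<in> F" and y: "y \<in> F"
  shows "body_gauge L (x + y) \<le> body_gauge L x + R * norm y"
proof (rule field_le_epsilon)
  fix e :: real assume e: "0 < e"
  define c where "c = body_gauge L x + e / 2"
  define d where "d = max 0 (R * norm y) + e / 2"
  have pos: "0 < c" "0 < d" using gauge_nonneg[OF x] e by (auto simp: c_def d_def)
  have xc: "x /\<^sub>R c \<in> L" using gauge_less_imp_mem[OF x, of c] e by (simp add: c_def)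
  have yd: "y /\<^sub>R d \<in> L" using e by (intro mem_of_norm[OF y _ pos(2)]) (auto simp: d_def)
  have "(c / (c + d)) *\<^sub>R (x /\<^sub>R c) + (d / (c + d)) *\<^sub>R (y /\<^sub>R d) \<in> L"
    using pos by (intro convexD[OF convex_L xc yd]) (auto simp: add_divide_distrib[symmetric])
  moreover have "c / (c + d) * inverse c = inverse (c + d)" "d / (c + d) * inverse d = inverse (c + d)"
    using pos by (simp_all add: field_simps)
  ultimately have "(x + y) /\<^sub>R (c + d) \<in> L"
    by (simp add: scaleR_add_right)
  then have "body_gauge L (x + y) \<le> c + d" using pos by (intro gauge_le) auto
  moreover have "0 \<le> R * norm y"
  proof (cases "y = 0")
    case False
    then have "0 < R" using R_pos y by blast
    then show ?thesis by simp
  qed simp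
  ultimately show "body_gauge L (x + y) \<le> body_gauge L x + R * norm y + e"
    by (simp add: c_def d_def)
qed

text \<open>
Outside of \<open>F\<close> the gauge is the infimum of the empty set.  Composing it with the orthogonal projection gives a function
that is Lipschitz on the whole space.
\<close>

definition gauge_ext :: "'a \<Rightarrow> real" where
  "gauge_ext x = body_gauge L (closest_point F x)"

lemma gauge_ext_eq: "x \<in> F \<Longrightarrow> gauge_ext x = body_gauge L x"
  by (simp add: gauge_ext_def closest_point_self)

lemma gauge_ext_lipschitz:
  assumes "F \<noteq> {0}"
  shows "R-lipschitz_on UNIV gauge_ext"
proof (rule lipschitz_onI)
  show R: "0 \<le> R" using R_pos[OF assms] by simp
  fix x y
  note P = closest_point_subspace(1)[OF F]
  have "gauge_ext a \<le> gauge_ext b + R * norm (closest_point F a - closest_point F b)" for a b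
    using gauge_add[of "closest_point F b" "closest_point F a - closest_point F b"] P F
    by (simp add: gauge_ext_def subspace_diff)
  from this[of x y] this[of y x]
  have "dist (gauge_ext x) (gauge_ext y) \<le> R * dist (closest_point F x) (closest_point F y)"
    by (simp add: dist_norm norm_minus_commute[of "closest_point F y"] abs_le_iff)
  also have "\<dots> \<le> R * dist x y"
    using R F by (intro mult_left_mono closest_point_lipschitz)
      (auto simp: subspace_imp_convex closed_subspace dest: subspace_0)
  finally show "dist (gauge_ext x) (gauge_ext y) \<le> R * dist x y" .
qed

lemma gauge_measurable:
  assumes "F \<noteq> {0}"
  shows "body_gauge L \<in> borel_measurable borel"
proof -
  have [measurable]: "gauge_ext \<in> borel_measurable borel"
    using lipschitz_on_continuous_on[OF gauge_ext_lipschitz[OF assms]] by (rule borel_measurable_continuous_onI)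
  have [measurable]: "F \<in> sets borel" using closed_subspace[OF F] by simp
  have "body_gauge L x = (if x \<in> F then gauge_ext x else Inf {})" for x
  proof (cases "x \<in> F")
    case False
    have "x /\<^sub>R c \<notin> L" if "0 < c" for c
      using False subspace_scale[OF F, of "x /\<^sub>R c" c] that by (auto simp: L_def)
    then have empty: "{c. 0 < c \<and> x /\<^sub>R c \<in> L} = {}" by auto
    show ?thesis unfolding gauge_eq empty using False by simp
  qed (simp add: gauge_ext_eq)
  then have "body_gauge L = (\<lambda>x. if x \<in> F then gauge_ext x else Inf {})" by (rule ext)
  then show ?thesis by simp
qed

end

lemma orthonormal_basis_std_gaussian:
  fixes F :: "'a::euclidean_space set"
  assumes F: "subspace F"
  obtains B where "orthonormal B" "span B = F" "card B = dim F"
    "std_gaussian_on F = distr (gauss_coords B) borel (vec_of B)"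
proof -
  define B where "B = (SOME B. orthonormal_basis_of F B)"
  have "\<exists>B. orthonormal_basis_of F B"
    using orthonormal_basis_subspace[OF F] unfolding orthonormal_basis_of_def by metis
  then have B: "orthonormal_basis_of F B" unfolding B_def by (rule someI_ex)
  then have "independent B"
    by (intro pairwise_orthogonal_independent) (auto simp: orthonormal_basis_of_def)
  then have "finite B" "card B = dim (span B)"
    using independent_imp_finite by (auto simp: dim_eq_card_independent)
  show ?thesis
  proof (rule that)
    show "orthonormal B" using B \<open>finite B\<close> by (simp add: orthonormal_def orthonormal_basis_of_def)
    show "span B = F" using B by (simp add: orthonormal_basis_of_def)
    then show "card B = dim F" using \<open>card B = dim (span B)\<close> by simp
    show "std_gaussian_on F = distr (gauss_coords B) borel (vec_of B)"
      unfolding std_gaussian_on_def Let_def B_def[symmetric] gauss_coords_def vec_of_def[abs_def] ..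
  qed
qed

section \<open>The random radius\<close>

text \<open>
The radius is attained by compactness, so the event in question is that the random subspace meets a fixed compact set;
in particular it is measurable.
\<close>

lemma outer_radius_ge_iff:
  fixes K E :: "'a::euclidean_space set"
  assumes K: "convex_body K" and E: "subspace E"
  shows "r \<le> outer_radius (E \<inter> K) \<longleftrightarrow> E \<inter> (K \<inter> {y. r \<le> norm y}) \<noteq> {}"
proof -
  have K': "compact K" "0 \<in> K" using K interior_subset by (auto simp: convex_body_def)
  have comp: "compact (E \<inter> K)" using closed_subspace[OF E] K'(1) by (rule closed_Int_compact)
  have ne: "E \<inter> K \<noteq> {}" using subspace_0[OF E] K'(2) by blast
  obtain y where y: "y \<in> E \<inter> K" "\<And>z. z \<in> E \<inter> K \<Longrightarrow> norm z \<le> norm y"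
    using continuous_attains_sup[OF comp ne, of norm] by (auto intro: continuous_intros)
  have "outer_radius (E \<inter> K) = norm y"
    unfolding outer_radius_def using y ne by (intro cSup_eq_maximum) auto
  then show ?thesis using y by (auto intro: order_trans)
qed

theorem theorem1p5:
  fixes n :: nat
    and K F :: "(real^'N) set"
    and t :: real
    and M :: "'w measure"
    and E :: "'w \<Rightarrow> (real^'N) set"
  assumes "1 \<le> n" and "n < CARD('N)"
    and "convex_body K"
    and "prob_space M"
    and "E \<in> M \<rightarrow>\<^sub>M grassmannian (CARD('N) - n)"
    and "haar_grassmannian (CARD('N) - n) (distr M (grassmannian (CARD('N) - n)) E)"
    and "subspace F" and "dim F = n + 1"
    and "t > 0"
  shows "measure M {\<omega> \<in> space M.
            outer_radius (E \<omega> \<inter> K) \<ge>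
              sqrt (real n) / (2 * (ell F (K \<inter> F) + t * outer_radius (polar_in F (K \<inter> F))))}
         \<ge> 1 - exp (- real n / 8) - exp (- (t\<^sup>2) / 2)"
proof -
  note K = assms(3) and Em = assms(5) and haar = assms(6) and F = assms(7) and dimF = assms(8)
  interpret M: prob_space M by fact
  interpret body_section K F "K \<inter> F" by unfold_locales (use K F in auto)
  have F0: "F \<noteq> {0}" using dimF by auto
  obtain B where B: "orthonormal B" "span B = F" "card B = n + 1"
      and law: "std_gaussian_on F = distr (gauss_coords B) borel (vec_of B)"
    using orthonormal_basis_std_gaussian[OF F] dimF by metis
  interpret G: prob_space "gauss_coords B" by (rule prob_space_gauss_coords)
  have Gin: "vec_of B \<omega> \<in> F" for \<omega> using vec_of_in_span[of B \<omega>] B(2) by simp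
  define l where "l = ell F (K \<inter> F)"
  have l: "l = (\<integral>\<omega>. gauge_ext (vec_of B \<omega>) \<partial>gauss_coords B)"
    unfolding l_def ell_def law
    by (subst integral_distr) (auto simp: gauge_measurable[OF F0] gauge_ext_eq[OF Gin])
  have "0 \<le> l"
    unfolding l by (intro Bochner_Integration.integral_nonneg) (simp add: gauge_ext_eq[OF Gin] gauge_nonneg[OF Gin])
  define c where "c = l + t * R"
  have c: "0 < c" using \<open>0 \<le> l\<close> R_pos[OF F0] assms(9) by (simp add: c_def add_nonneg_pos)
  define r where "r = sqrt (real n) / (2 * c)"
  have r: "0 \<le> r" using c by (simp add: r_def)
  (* The directions of F in which K reaches at least as far as r. *)
  define D where "D = (F \<inter> sphere 0 1) \<inter> {x. r *\<^sub>R x \<in> K}"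
  have D: "compact D"
  proof -
    have "closed ((\<lambda>x. r *\<^sub>R x) -` K)"
      using K by (intro continuous_closed_vimage) (auto simp: convex_body_def compact_imp_closed)
    then show ?thesis
      unfolding D_def vimage_def by (intro compact_Int_closed compact_sphere_Int_subspace F)
  qed
  have Dm[measurable]: "D \<in> sets borel" using D by (simp add: compact_imp_closed)
  have mg[measurable]: "gauge_ext \<in> borel_measurable borel"
    using lipschitz_on_continuous_on[OF gauge_ext_lipschitz[OF F0]] by (rule borel_measurable_continuous_onI)
  let ?small = "{\<omega> \<in> space (gauss_coords B). norm (vec_of B \<omega>) \<le> sqrt (real n) / 2}"
  let ?large = "{\<omega> \<in> space (gauss_coords B). gauge_ext (vec_of B \<omega>) \<ge> c}"
  let ?good = "{\<omega> \<in> space (gauss_coords B). sgn (vec_of B \<omega>) \<in> D}"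
  have small: "G.prob ?small \<le> exp (- real n / 8)"
    by (rule gaussian_small_ball[OF B(1,3)])
  have large: "G.prob ?large \<le> exp (- t\<^sup>2 / 2)"
    using gaussian_concentration[OF B(1) gauge_ext_lipschitz[OF F0] R_pos[OF F0] assms(9)]
    by (simp add: c_def l)
  (* If G is neither short nor of large gauge, then G / c lies in K, and r * c = sqrt n / 2 is less
    than the norm of G, so that the shorter vector r * sgn G lies in K as well. *)
  have cover: "space (gauss_coords B) \<subseteq> ?good \<union> (?small \<union> ?large)"
  proof
    fix \<omega> assume \<omega>: "\<omega> \<in> space (gauss_coords B)"
    show "\<omega> \<in> ?good \<union> (?small \<union> ?large)"
    proof (rule ccontr)
      define x where "x = vec_of B \<omega>"
      assume "\<omega> \<notin> ?good \<union> (?small \<union> ?large)"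
      then have x: "sqrt (real n) / 2 < norm x" "gauge_ext x < c" "sgn x \<notin> D"
        using \<omega> by (auto simp: x_def)
      have "0 \<le> sqrt (real n) / 2" by simp
      then have x0: "0 < norm x" using x(1) by linarith
      have xF: "x \<in> F" using Gin by (simp add: x_def)
      have xc: "x /\<^sub>R c \<in> K \<inter> F"
        using x(2) by (intro gauge_less_imp_mem xF) (simp add: gauge_ext_eq[OF xF])
      have "r * c / norm x \<le> 1"
        using x(1) x0 c by (simp add: r_def divide_le_eq)
      then have "(r * c / norm x) *\<^sub>R (x /\<^sub>R c) \<in> K \<inter> F"
        using r c by (intro convex_shrink[OF convex_L zero_L xc]) auto
      moreover have "(r * c / norm x) * inverse c = r * inverse (norm x)"
        using c x0 by (simp add: field_simps)
      ultimately have "r *\<^sub>R sgn x \<in> K" by (simp add: sgn_div_norm)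
      moreover have "sgn x \<in> F \<inter> sphere 0 1"
        using xF x0 F by (simp add: norm_sgn sgn_div_norm subspace_scale)
      ultimately show False using x(3) by (simp add: D_def)
    qed
  qed
  have good: "1 - exp (- real n / 8) - exp (- t\<^sup>2 / 2) \<le> G.prob ?good"
  proof -
    have "1 = G.prob (space (gauss_coords B))" by (simp add: G.prob_space)
    also have "\<dots> \<le> G.prob (?good \<union> (?small \<union> ?large))"
      by (rule G.finite_measure_mono[OF cover]) measurable
    also have "\<dots> \<le> G.prob ?good + G.prob (?small \<union> ?large)"
      by (rule measure_Un_le) measurable
    also have "G.prob (?small \<union> ?large) \<le> G.prob ?small + G.prob ?large"
      by (rule measure_Un_le) measurable
    finally show ?thesis using small large by linarith
  qed
  have Bne: "B \<noteq> {}" using B(3) by auto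
  interpret dir: invariant_direction "gauss_direction B" F
  proof (intro invariant_direction.intro prob_space_gauss_direction, unfold_locales)
    show "AE y in gauss_direction B. y \<in> F \<inter> sphere 0 1"
      using gauss_direction_sphere[OF B(1) Bne] B(2) by simp
    show "distr (gauss_direction B) borel (reflection v) = gauss_direction B" if "v \<in> F" for v
      using gauss_direction_reflection[OF B(1)] that B(2) by simp
  qed (use F in \<open>auto simp: gauss_direction_def\<close>)
  let ?k = "CARD('N) - n"
  let ?\<mu> = "distr M (grassmannian ?k) E"
  let ?C = "K \<inter> {y. r \<le> norm y}"
  have "compact ?C"
    using K by (intro compact_Int_closed closed_Collect_le continuous_intros) (auto simp: convex_body_def)
  then have meas: "{W \<in> space (grassmannian ?k). W \<inter> ?C \<noteq> {}} \<in> sets (grassmannian ?k)"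
    by (rule sets_grassmannian_meets)
  have sub: "{W \<in> space (grassmannian ?k). W \<inter> D \<noteq> {}} \<subseteq> {W \<in> space (grassmannian ?k). W \<inter> ?C \<noteq> {}}"
  proof safe
    fix W x assume W: "W \<in> space (grassmannian ?k)" and x: "x \<in> W" "x \<in> D" and "W \<inter> ?C = {}"
    have "r *\<^sub>R x \<in> W \<inter> ?C"
      using W x r by (auto simp: D_def space_grassmannian subspace_scale)
    then show False using \<open>W \<inter> ?C = {}\<close> by blast
  qed
  have "emeasure (gauss_direction B) D \<le> emeasure ?\<mu> {W \<in> space ?\<mu>. W \<inter> D \<noteq> {}}"
    by (rule dir.haar_meets[OF haar _ D]) (use assms(2) dimF in \<open>auto simp: D_def dir.S_def\<close>)
  also have "\<dots> \<le> emeasure ?\<mu> {W \<in> space (grassmannian ?k). W \<inter> ?C \<noteq> {}}"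
    using sub meas by (intro emeasure_mono) auto
  also have "\<dots> = emeasure M (E -` {W \<in> space (grassmannian ?k). W \<inter> ?C \<noteq> {}} \<inter> space M)"
    by (rule emeasure_distr[OF Em meas])
  also have "E -` {W \<in> space (grassmannian ?k). W \<inter> ?C \<noteq> {}} \<inter> space M = {\<omega> \<in> space M. r \<le> outer_radius (E \<omega> \<inter> K)}"
    using measurable_space[OF Em] outer_radius_ge_iff[OF K] by (auto simp: space_grassmannian)
  finally have "emeasure (gauss_direction B) D \<le> emeasure M {\<omega> \<in> space M. r \<le> outer_radius (E \<omega> \<inter> K)}" .
  moreover have "emeasure (gauss_direction B) D = emeasure (gauss_coords B) ?good"
    unfolding gauss_direction_def by (subst emeasure_distr) (auto intro!: arg_cong2[where f=emeasure])
  ultimately have "G.prob ?good \<le> M.prob {\<omega> \<in> space M. r \<le> outer_radius (E \<omega> \<inter> K)}"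
    by (simp add: G.emeasure_eq_measure M.emeasure_eq_measure)
  then show ?thesis using good by (simp add: r_def c_def l_def)
qed

end
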